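(* Let $\Omega\subset\mathbb{R}^d$ be a bounded domain with Lipschitz boundary. Let $\gamma:\mathbb{R}^d\to\mathbb{R}$ be positively homogeneous of degree one ($\gamma(\lambda q)=\lambda\gamma(q)$ for all $q\in\mathbb{R}^d\setminus\{0\}$, $\lambda\ge 0$), positive on $\mathbb{R}^d\setminus\{0\}$, and convex. Set $A(q)=\tfrac12|\gamma(q)|^2$ for $q\in\mathbb{R}^d$ and define $\mathcal{F}:H^1(\Omega)\to\mathbb{R}$ by $\mathcal{F}(\varphi)=\int_\Omega A(\nabla\varphi)\,dx$. Consider the map $\mathcal{G}:H^1(\Omega)\to 2^{H^1(\Omega)^*}$ defined by $$\mathcal{G}(\varphi)=\Big\{v\in H^1(\Omega)^*:\ \exists\,\xi\in L^2(\Omega,\mathbb{R}^d)\text{ such that }\xi\in\partial A(\nabla\varphi)\text{ a.e. in }\Omega\text{ and }\langle v,p\rangle_{H^1}=\int_\Omega\xi\cdot\nabla p\,dx\ \ \forall p\in H^1(\Omega)\Big\}.$$ Then for every $\varphi\in D(\partial\mathcal{F})$ it holds that $\partial\mathcal{F}(\varphi)=\mathcal{G}(\varphi)$.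
   Context: $H^1(\Omega)^*$ is the dual of $H^1(\Omega)$ with duality pairing $\langle\cdot,\cdot\rangle_{H^1}$. The subdifferential of $\mathcal{F}$ is $\partial\mathcal{F}(\varphi)=\{\xi\in H^1(\Omega)^*:\mathcal{F}(\phi)-\mathcal{F}(\varphi)\ge\langle\xi,\phi-\varphi\rangle_{H^1}\ \forall\phi\in H^1(\Omega)\}$, and $D(\partial\mathcal{F})=\{\varphi\in H^1(\Omega):\partial\mathcal{F}(\varphi)\neq\emptyset\}$. The subdifferential of $A$ is $\partial A(q)=\{\xi\in\mathbb{R}^d:A(r)-A(q)\ge\xi\cdot(r-q)\ \forall r\in\mathbb{R}^d\}$. *)

theory Defs
  imports "HOL-Analysis.Analysis"
begin

text \<open>Throughout, the space \<open>\<real>\<^sup>d\<close> is a type of class \<^class>\<open>euclidean_space\<close>, and functions on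
  \<open>\<Omega>\<close> are total functions of which only the values on \<open>\<Omega>\<close> matter. Elements of \<open>L\<^sup>2(\<Omega>)\<close> and
  \<open>H\<^sup>1(\<Omega>)\<close> are represented by functions rather than by their a.e.-equality classes.\<close>

subsection \<open>Lipschitz boundary\<close>

text \<open>Near every boundary point, \<open>\<Omega>\<close> is the strict epigraph, in some unit direction \<open>e\<close>, of a
  Lipschitz function on the hyperplane orthogonal to \<open>e\<close>.\<close>

definition lipschitz_boundary :: "'a::euclidean_space set \<Rightarrow> bool" where
  "lipschitz_boundary \<Omega> \<longleftrightarrow>
    (\<forall>x\<in>frontier \<Omega>. \<exists>U e g L. open U \<and> x \<in> U \<and> norm e = 1 \<and>
       L-lipschitz_on {y. y \<bullet> e = 0} (g :: 'a \<Rightarrow> real) \<and>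
       \<Omega> \<inter> U = {y \<in> U. g (y - (y \<bullet> e) *\<^sub>R e) < y \<bullet> e})"

subsection \<open>Weak gradients\<close>

fun C_k :: "nat \<Rightarrow> ('a::euclidean_space \<Rightarrow> real) \<Rightarrow> bool" where
  "C_k 0 f \<longleftrightarrow> continuous_on UNIV f"
| "C_k (Suc k) f \<longleftrightarrow> (\<forall>x. f differentiable (at x)) \<and>
     (\<forall>b\<in>Basis. C_k k (\<lambda>x. frechet_derivative f (at x) b))"

definition test_functions :: "'a::euclidean_space set \<Rightarrow> ('a \<Rightarrow> real) set" where
  "test_functions \<Omega> = {\<psi>. (\<forall>k. C_k k \<psi>) \<and> compact (closure {x. \<psi> x \<noteq> 0}) \<and>
     closure {x. \<psi> x \<noteq> 0} \<subseteq> \<Omega>}"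

definition locally_integrable ::
    "'a::euclidean_space set \<Rightarrow> ('a \<Rightarrow> 'b::euclidean_space) \<Rightarrow> bool" where
  "locally_integrable \<Omega> f \<longleftrightarrow> (\<forall>K. compact K \<and> K \<subseteq> \<Omega> \<longrightarrow> f absolutely_integrable_on K)"

definition has_weak_gradient ::
    "'a::euclidean_space set \<Rightarrow> ('a \<Rightarrow> real) \<Rightarrow> ('a \<Rightarrow> 'a) \<Rightarrow> bool" where
  "has_weak_gradient \<Omega> u g \<longleftrightarrow> locally_integrable \<Omega> u \<and> locally_integrable \<Omega> g \<and>
    (\<forall>\<psi>\<in>test_functions \<Omega>. \<forall>b\<in>Basis.
       (LINT x|lebesgue_on \<Omega>. u x * frechet_derivative \<psi> (at x) b) =
       - (LINT x|lebesgue_on \<Omega>. (g x \<bullet> b) * \<psi> x))"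

text \<open>For open \<open>\<Omega>\<close> a weak gradient is unique up to null sets; the choice below fixes a
  representative, which is the same for all representatives of the a.e.-class of \<open>u\<close>.\<close>

definition weak_grad :: "'a::euclidean_space set \<Rightarrow> ('a \<Rightarrow> real) \<Rightarrow> 'a \<Rightarrow> 'a" where
  "weak_grad \<Omega> u = (SOME g. has_weak_gradient \<Omega> u g)"

subsection \<open>The spaces \<open>L\<^sup>2\<close> and \<open>H\<^sup>1\<close>, and the dual of \<open>H\<^sup>1\<close>\<close>

definition L2 :: "'a::euclidean_space set \<Rightarrow> ('a \<Rightarrow> 'b::euclidean_space) set" where
  "L2 \<Omega> = {f \<in> borel_measurable (lebesgue_on \<Omega>).
     integrable (lebesgue_on \<Omega>) (\<lambda>x. (norm (f x))\<^sup>2)}"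

definition H1 :: "'a::euclidean_space set \<Rightarrow> ('a \<Rightarrow> real) set" where
  "H1 \<Omega> = {u \<in> L2 \<Omega>. \<exists>g\<in>L2 \<Omega>. has_weak_gradient \<Omega> u g}"

definition H1_norm :: "'a::euclidean_space set \<Rightarrow> ('a \<Rightarrow> real) \<Rightarrow> real" where
  "H1_norm \<Omega> u = sqrt ((LINT x|lebesgue_on \<Omega>. (u x)\<^sup>2) +
     (LINT x|lebesgue_on \<Omega>. (norm (weak_grad \<Omega> u x))\<^sup>2))"

text \<open>Boundedness forces a functional to take the same value on a.e.-equal representatives, so these
  are exactly the bounded linear functionals on the space of a.e.-classes. They are extensional, so
  that equality of functionals is equality on \<open>H1 \<Omega>\<close>.\<close>

definition H1_dual :: "'a::euclidean_space set \<Rightarrow> (('a \<Rightarrow> real) \<Rightarrow> real) set" where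
  "H1_dual \<Omega> = {v \<in> extensional (H1 \<Omega>).
     (\<forall>p\<in>H1 \<Omega>. \<forall>q\<in>H1 \<Omega>. v (\<lambda>x. p x + q x) = v p + v q) \<and>
     (\<forall>c. \<forall>p\<in>H1 \<Omega>. v (\<lambda>x. c * p x) = c * v p) \<and>
     (\<exists>C. \<forall>p\<in>H1 \<Omega>. \<bar>v p\<bar> \<le> C * H1_norm \<Omega> p)}"

subsection \<open>Subdifferentials\<close>

definition subdiff :: "('a::euclidean_space \<Rightarrow> real) \<Rightarrow> 'a \<Rightarrow> 'a set" where
  "subdiff A q = {\<xi>. \<forall>r. A r - A q \<ge> \<xi> \<bullet> (r - q)}"

definition H1_subdiff ::
    "'a::euclidean_space set \<Rightarrow> (('a \<Rightarrow> real) \<Rightarrow> real) \<Rightarrow> ('a \<Rightarrow> real) \<Rightarrow> (('a \<Rightarrow> real) \<Rightarrow> real) set"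
  where
  "H1_subdiff \<Omega> F \<phi> = {v \<in> H1_dual \<Omega>. \<forall>\<eta>\<in>H1 \<Omega>. F \<eta> - F \<phi> \<ge> v (\<lambda>x. \<eta> x - \<phi> x)}"

definition H1_subdiff_dom ::
    "'a::euclidean_space set \<Rightarrow> (('a \<Rightarrow> real) \<Rightarrow> real) \<Rightarrow> ('a \<Rightarrow> real) set" where
  "H1_subdiff_dom \<Omega> F = {\<phi> \<in> H1 \<Omega>. H1_subdiff \<Omega> F \<phi> \<noteq> {}}"

subsection \<open>The anisotropic energy\<close>

definition aniso_density :: "('a::euclidean_space \<Rightarrow> real) \<Rightarrow> 'a \<Rightarrow> real" where
  "aniso_density \<gamma> q = 1/2 * \<bar>\<gamma> q\<bar>\<^sup>2"

definition grad_energy ::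
    "'a::euclidean_space set \<Rightarrow> ('a \<Rightarrow> real) \<Rightarrow> ('a \<Rightarrow> real) \<Rightarrow> real" where
  "grad_energy \<Omega> A \<phi> = (LINT x|lebesgue_on \<Omega>. A (weak_grad \<Omega> \<phi> x))"

definition grad_subdiff ::
    "'a::euclidean_space set \<Rightarrow> ('a \<Rightarrow> real) \<Rightarrow> ('a \<Rightarrow> real) \<Rightarrow> (('a \<Rightarrow> real) \<Rightarrow> real) set" where
  "grad_subdiff \<Omega> A \<phi> = {v \<in> H1_dual \<Omega>. \<exists>\<xi>\<in>L2 \<Omega>.
     (AE x in lebesgue_on \<Omega>. \<xi> x \<in> subdiff A (weak_grad \<Omega> \<phi> x)) \<and>
     (\<forall>p\<in>H1 \<Omega>. v p = (LINT x|lebesgue_on \<Omega>. \<xi> x \<bullet> weak_grad \<Omega> p x))}"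

end

theory Submission
  imports Defs "HOL-Library.Function_Algebras"
begin

text \<open>
  With \<open>\<Phi>(h) = \<integral> A(h) dx\<close> on \<open>L\<^sup>2(\<Omega>, \<real>\<^sup>d)\<close> the energy is \<open>\<F> = \<Phi> \<circ> \<nabla>\<close>, and the claim is the chain
  rule \<open>\<partial>\<F>(\<phi>) = \<nabla>\<^sup>* \<partial>\<Phi>(\<nabla>\<phi>)\<close> together with the fact that subgradients of \<open>\<Phi>\<close> are the pointwise
  ones. The inclusion \<open>\<G>(\<phi>) \<subseteq> \<partial>\<F>(\<phi>)\<close> is the integral of the inequality
  \<open>\<xi>(x) \<bullet> (\<nabla>\<eta>(x) - \<nabla>\<phi>(x)) \<le> A(\<nabla>\<eta>(x)) - A(\<nabla>\<phi>(x))\<close>.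

  For the converse let \<open>v \<in> \<partial>\<F>(\<phi>)\<close>, \<open>g = \<nabla>\<phi>\<close> and \<open>\<Psi>(h) = \<Phi>(g + h) - \<Phi>(g)\<close>. Then \<open>v(p) \<le> \<Psi>(\<nabla>p)\<close> for all
  \<open>p\<close>, so \<open>\<nabla>p \<mapsto> v(p)\<close> is a well-defined linear functional on the space of gradients that lies below
  the convex function \<open>\<Psi>\<close>. As \<open>\<Psi>\<close> is finite on all of \<open>L\<^sup>2\<close>, the Hahn-Banach theorem in its convex
  form (\<open>hahn_banach_convex\<close>) extends it to a linear \<open>L \<le> \<Psi>\<close> on \<open>L\<^sup>2\<close>. The density \<open>\<xi>\<close> of \<open>L\<close> is found
  without topology on \<open>L\<^sup>2\<close> (\<open>majorised_functional_density\<close>). For fixed \<open>q\<close>, the bound \<open>L \<le> \<Psi>\<close> makes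
  \<open>E \<mapsto> L(1\<^sub>E q)\<close> a signed measure dominated by an integrable density, so the Radon-Nikodym
  theorem applies. The inequality \<open>\<integral>\<^sub>E \<xi> \<bullet> q \<le> \<integral>\<^sub>E A(g + q) - A(g)\<close> for all \<open>E\<close> localises to almost every point,
  simultaneously for a countable dense set of \<open>q\<close> and hence for all \<open>q\<close>; that is,
  \<open>\<xi>(x) \<in> \<partial>A(g(x))\<close>. Quadratic growth of \<open>A\<close> turns this into \<open>|\<xi>| \<le> c |g|\<close>, so \<open>\<xi> \<in> L\<^sup>2\<close>. Finally \<open>L\<close>
  and \<open>h \<mapsto> \<integral> \<xi> \<bullet> h\<close> agree on simple functions, and their difference is below
  \<open>\<Psi>(h) - \<integral> \<xi> \<bullet> h\<close>, which tends to \<open>0\<close> along \<open>h - h\<^sub>n\<close> for simple \<open>h\<^sub>n \<rightarrow> h\<close>; so they agree everywhere.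

  Throughout, \<open>\<nabla>\<close> has to be linear up to null sets although it is defined by a choice. This is the
  uniqueness of weak gradients (\<open>weak_gradient_AE_unique\<close>), which needs enough test functions:
  smooth cut-offs that converge to the indicator of a box are built from \<open>exp(-1/t)\<close>.
\<close>

section \<open>Smooth cut-off functions of boxes\<close>

text \<open>For \<open>P = 1\<close> this is the classical function that is smooth but flat at \<open>0\<close>. The polynomial factor
  makes the family closed under differentiation.\<close>

definition flat :: "real poly \<Rightarrow> real \<Rightarrow> real" where
  "flat P t = (if t > 0 then poly P (1 / t) * exp (- (1 / t)) else 0)"

lemma poly_times_exp_minus_tendsto_0:
  fixes P :: "real poly"
  shows "((\<lambda>y. poly P y * exp (- y)) \<longlongrightarrow> 0) at_top"
proof -
  have "((\<lambda>y. \<Sum>i\<le>degree P. coeff P i * (y ^ i / exp y)) \<longlongrightarrow> (\<Sum>i\<le>degree P. coeff P i * 0)) at_top"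
    by (intro tendsto_sum tendsto_mult tendsto_const tendsto_power_div_exp_0)
  moreover have "poly P y * exp (- y) = (\<Sum>i\<le>degree P. coeff P i * (y ^ i / exp y))" for y :: real
    by (simp add: poly_altdef exp_minus divide_inverse sum_distrib_right mult.assoc)
  ultimately show ?thesis by simp
qed

lemma flat_has_derivative:
  "(flat P has_real_derivative flat ([:0, 0, 1:] * (P - pderiv P)) t) (at t)"
proof -
  consider "t > 0" | "t < 0" | "t = 0" by linarith
  then show ?thesis
  proof cases
    case 1
    have "((\<lambda>t. poly P (1 / t) * exp (- (1 / t))) has_real_derivative
        flat ([:0, 0, 1:] * (P - pderiv P)) t) (at t)"
      using 1 unfolding flat_def
      by (auto intro!: derivative_eq_intros DERIV_chain2[OF poly_DERIV]
          simp: field_simps power2_eq_square)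
    then show ?thesis
      by (rule has_field_derivative_transform_within_open[where S="{0<..}"])
        (use 1 in \<open>auto simp: flat_def\<close>)
  next
    case 2
    have "((\<lambda>t. 0) has_real_derivative flat ([:0, 0, 1:] * (P - pderiv P)) t) (at t)"
      using 2 by (simp add: flat_def)
    then show ?thesis
      by (rule has_field_derivative_transform_within_open[where S="{..<0}"])
        (use 2 in \<open>auto simp: flat_def\<close>)
  next
    case 3
    have "((\<lambda>h. flat P h / h) \<longlongrightarrow> 0) (at_left 0)"
      by (rule tendsto_eventually) (auto simp: eventually_at_left_field flat_def intro!: exI[of _ "-1"])
    moreover have "((\<lambda>h. flat P h / h) \<longlongrightarrow> 0) (at_right 0)"
    proof -
      have "((\<lambda>h. poly ([:0, 1:] * P) (inverse h) * exp (- inverse h)) \<longlongrightarrow> 0) (at_right 0)"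
        by (rule filterlim_compose[OF poly_times_exp_minus_tendsto_0 filterlim_inverse_at_top_right])
      then show ?thesis
        by (rule Lim_transform_eventually)
          (auto simp: eventually_at_right_field flat_def field_simps intro!: exI[of _ 1])
    qed
    ultimately have "((\<lambda>h. flat P h / h) \<longlongrightarrow> 0) (at 0)"
      by (rule filterlim_split_at)
    then show ?thesis
      unfolding 3 DERIV_def by (simp add: flat_def)
  qed
qed

text \<open>Infinite differentiability is obtained from an algebra of functions that contains, with each member,
  its partial derivatives; the constants are there because the chain rule produces them.\<close>

inductive_set smooth_alg :: "('a::euclidean_space \<Rightarrow> real) set" where
  flat: "(\<lambda>x. flat P (w \<bullet> x + c)) \<in> smooth_alg"
| const: "(\<lambda>x. c) \<in> smooth_alg"
| add: "f \<in> smooth_alg \<Longrightarrow> g \<in> smooth_alg \<Longrightarrow> (\<lambda>x. f x + g x) \<in> smooth_alg"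
| mult: "f \<in> smooth_alg \<Longrightarrow> g \<in> smooth_alg \<Longrightarrow> (\<lambda>x. f x * g x) \<in> smooth_alg"

lemma smooth_alg_derivative:
  assumes "f \<in> smooth_alg"
  shows "\<exists>D. (\<forall>x. (f has_derivative D x) (at x)) \<and> (\<forall>b. (\<lambda>x. D x b) \<in> smooth_alg)"
  using assms
proof induction
  case (flat P w c)
  let ?Q = "[:0, 0, 1:] * (P - pderiv P)"
  have "((\<lambda>x. flat P (w \<bullet> x + c)) has_derivative (\<lambda>b. flat ?Q (w \<bullet> x + c) * (w \<bullet> b))) (at x)" for x
    by (rule has_derivative_compose[of "\<lambda>x. w \<bullet> x + c" _ x UNIV, 
          OF _ flat_has_derivative[of P, unfolded has_field_derivative_def]])
       (auto intro!: derivative_eq_intros)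
  then show ?case
    by (intro exI[of _ "\<lambda>x b. flat ?Q (w \<bullet> x + c) * (w \<bullet> b)"] conjI allI)
      (auto intro: smooth_alg.intros)
next
  case (const c)
  then show ?case
    by (intro exI[of _ "\<lambda>x b. 0"]) (auto intro: smooth_alg.intros)
next
  case (add f g)
  then obtain D E where "\<And>x. (f has_derivative D x) (at x)" "\<And>b. (\<lambda>x. D x b) \<in> smooth_alg"
    "\<And>x. (g has_derivative E x) (at x)" "\<And>b. (\<lambda>x. E x b) \<in> smooth_alg"
    by blast
  then show ?case
    by (intro exI[of _ "\<lambda>x b. D x b + E x b"]) (auto intro: smooth_alg.intros has_derivative_add)
next
  case (mult f g)
  then obtain D E where "\<And>x. (f has_derivative D x) (at x)" "\<And>b. (\<lambda>x. D x b) \<in> smooth_alg"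
    "\<And>x. (g has_derivative E x) (at x)" "\<And>b. (\<lambda>x. E x b) \<in> smooth_alg"
    by blast
  with mult.hyps show ?case
    by (intro exI[of _ "\<lambda>x b. f x * E x b + D x b * g x"] conjI allI
        has_derivative_mult smooth_alg.add smooth_alg.mult)
qed

lemma smooth_alg_C_k: "f \<in> smooth_alg \<Longrightarrow> C_k k f"
proof (induction k arbitrary: f)
  case 0
  then obtain D where "\<And>x. (f has_derivative D x) (at x)"
    using smooth_alg_derivative by blast
  then show ?case
    by (auto intro!: continuous_at_imp_continuous_on intro: has_derivative_continuous)
next
  case (Suc k)
  obtain D where D: "\<And>x. (f has_derivative D x) (at x)" "\<And>b. (\<lambda>x. D x b) \<in> smooth_alg"
    using smooth_alg_derivative[OF Suc.prems] by blast
  have "frechet_derivative f (at x) = D x" for x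
    using frechet_derivative_at[OF D(1)] by simp
  with D Suc.IH show ?case
    by (auto simp: differentiable_def)
qed

lemma smooth_alg_prod:
  "finite I \<Longrightarrow> (\<And>i. i \<in> I \<Longrightarrow> f i \<in> smooth_alg) \<Longrightarrow> (\<lambda>x. \<Prod>i\<in>I. f i x) \<in> smooth_alg"
  by (induction I rule: finite_induct) (auto intro: smooth_alg.intros)

definition box_cutoff :: "'a::euclidean_space \<Rightarrow> 'a \<Rightarrow> nat \<Rightarrow> 'a \<Rightarrow> real" where
  "box_cutoff a c n x = (\<Prod>b\<in>Basis. flat 1 (real (Suc n) * ((x - a) \<bullet> b)) * flat 1 (real (Suc n) * ((c - x) \<bullet> b)))"

lemma flat_1_bounds: "0 \<le> flat 1 t" "flat 1 t \<le> 1"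
  by (auto simp: flat_def)

lemma box_cutoff_bounds: "0 \<le> box_cutoff a c n x" "box_cutoff a c n x \<le> 1"
  unfolding box_cutoff_def
  by (auto intro!: prod_nonneg prod_le_1 mult_nonneg_nonneg mult_le_one simp: flat_1_bounds)

lemma box_cutoff_nonzero_iff: "box_cutoff a c n x \<noteq> 0 \<longleftrightarrow> x \<in> box a c"
  by (auto simp: box_cutoff_def flat_def mem_box zero_less_mult_iff inner_diff_left)

text \<open>The factor \<open>Suc n\<close> scales the argument of \<open>exp(-1/t)\<close> to infinity at each point of the open box, where
  the exponential tends to \<open>1\<close>.\<close>

lemma box_cutoff_tendsto: "(\<lambda>n. box_cutoff a c n x) \<longlonglongrightarrow> indicat_real (box a c) x"
proof (cases "x \<in> box a c")
  case True
  have *: "(\<lambda>n. flat 1 (real (Suc n) * t)) \<longlonglongrightarrow> 1" if "t > 0" for t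
  proof -
    have "(\<lambda>n. exp (- (inverse (real (Suc n)) * inverse t))) \<longlonglongrightarrow> exp (- (0 * inverse t))"
      by (intro tendsto_intros LIMSEQ_inverse_real_of_nat)
    moreover have "flat 1 (real (Suc n) * t) = exp (- (inverse (real (Suc n)) * inverse t))" for n
      using that by (simp add: flat_def field_simps del: of_nat_Suc)
    ultimately show ?thesis by (simp del: of_nat_Suc)
  qed
  have "(\<lambda>n. box_cutoff a c n x) \<longlonglongrightarrow> (\<Prod>b\<in>(Basis::'a set). 1 * 1)"
    unfolding box_cutoff_def
    by (intro tendsto_prod tendsto_mult *) (use True in \<open>auto simp: mem_box inner_diff_left\<close>)
  with True show ?thesis by simp
next
  case False
  then have "box_cutoff a c n x = 0" for n
    using box_cutoff_nonzero_iff by blast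
  with False show ?thesis by simp
qed

lemma box_cutoff_test_function:
  assumes "cbox a c \<subseteq> \<Omega>"
  shows "box_cutoff a c n \<in> test_functions \<Omega>"
proof -
  have 1: "(\<lambda>x. flat 1 (real (Suc n) * ((x - a) \<bullet> b))) \<in> smooth_alg" for b
    using smooth_alg.flat[of 1 "real (Suc n) *\<^sub>R b" "- (real (Suc n) * (a \<bullet> b))"]
    by (simp add: inner_diff_left inner_commute algebra_simps)
  have 2: "(\<lambda>x. flat 1 (real (Suc n) * ((c - x) \<bullet> b))) \<in> smooth_alg" for b
    using smooth_alg.flat[of 1 "- real (Suc n) *\<^sub>R b" "real (Suc n) * (c \<bullet> b)"]
    by (simp add: inner_diff_left inner_commute algebra_simps)
  have smooth: "box_cutoff a c n \<in> smooth_alg"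
    unfolding box_cutoff_def[abs_def]
    by (intro smooth_alg_prod smooth_alg.mult 1 2) simp
  have "{x. box_cutoff a c n x \<noteq> 0} = box a c"
    using box_cutoff_nonzero_iff by blast
  moreover have "closure (box a c) \<subseteq> cbox a c"
    by (rule closure_minimal) (auto simp: box_subset_cbox)
  ultimately show ?thesis
    using smooth_alg_C_k[OF smooth] assms compact_Int_closed[OF compact_cbox closed_closure, of a c "box a c"]
    unfolding test_functions_def by (auto simp: Int_absorb1)
qed

section \<open>Uniqueness of weak gradients\<close>

lemma integrable_mult_compact_support:
  fixes f :: "'a::euclidean_space \<Rightarrow> 'b::euclidean_space"
  assumes "open \<Omega>" "locally_integrable \<Omega> f" "continuous_on UNIV \<psi>" "compact K" "K \<subseteq> \<Omega>"
    and zero: "\<And>x. x \<notin> K \<Longrightarrow> \<psi> x = 0"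
  shows "integrable (lebesgue_on \<Omega>) (\<lambda>x. \<psi> x *\<^sub>R f x)"
proof -
  have meas: "\<Omega> \<in> sets lebesgue" "K \<in> sets lebesgue"
    using assms(1,4) by (auto intro: lmeasurable_open fmeasurableD lmeasurable_compact)
  have "(\<lambda>x. \<psi> x *\<^sub>R f x) absolutely_integrable_on K"
  proof (rule absolutely_integrable_bounded_measurable_product[of scaleR])
    show "\<psi> \<in> borel_measurable (lebesgue_on K)"
      using assms(3) meas by (intro continuous_imp_measurable_on_sets_lebesgue) (auto intro: continuous_on_subset)
    show "bounded (\<psi> ` K)"
      using assms(3,4) by (intro compact_imp_bounded compact_continuous_image) (auto intro: continuous_on_subset)
    show "f absolutely_integrable_on K"
      using assms by (auto simp: locally_integrable_def)
  qed (use meas bounded_bilinear_scaleR in \<open>auto simp: bilinear_conv_bounded_bilinear\<close>)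
  moreover have "(\<lambda>x. indicat_real K x *\<^sub>R \<psi> x *\<^sub>R f x) = (\<lambda>x. indicat_real \<Omega> x *\<^sub>R \<psi> x *\<^sub>R f x)"
    using zero assms(5) by (intro ext) (auto split: split_indicator)
  ultimately show ?thesis
    using meas(1) by (subst integrable_restrict_space) (simp_all only: set_integrable_def space_completion space_lborel space_borel Int_UNIV_right)
qed

lemma test_function_continuous: "\<psi> \<in> test_functions \<Omega> \<Longrightarrow> continuous_on UNIV \<psi>"
  using C_k.simps(1) unfolding test_functions_def by blast

lemma test_function_partial_continuous:
  assumes "\<psi> \<in> test_functions \<Omega>" "b \<in> Basis"
  shows "continuous_on UNIV (\<lambda>x. frechet_derivative \<psi> (at x) b)"
proof -
  have "C_k (Suc 0) \<psi>"
    using assms(1) unfolding test_functions_def by blast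
  with assms(2) show ?thesis by simp
qed

lemma test_function_partial_support:
  assumes "x \<notin> closure {x. \<psi> x \<noteq> 0}"
  shows "frechet_derivative \<psi> (at x) b = (0::real)"
proof -
  have "((\<lambda>_. 0) has_derivative (\<lambda>_. 0)) (at x)" by simp
  then have "(\<psi> has_derivative (\<lambda>_. 0)) (at x)"
    by (rule has_derivative_transform_within_open[where s="- closure {x. \<psi> x \<noteq> 0}"])
      (use assms closure_subset[of "{x. \<psi> x \<noteq> 0}"] in auto)
  from frechet_derivative_at[OF this] show ?thesis by metis
qed

lemma test_function_support:
  assumes "\<psi> \<in> test_functions \<Omega>"
  shows "compact (closure {x. \<psi> x \<noteq> 0})" "closure {x. \<psi> x \<noteq> 0} \<subseteq> \<Omega>"
  using assms unfolding test_functions_def by blast+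

lemma test_function_integrable:
  fixes f :: "'a::euclidean_space \<Rightarrow> 'b::euclidean_space"
  assumes "open \<Omega>" "locally_integrable \<Omega> f" "\<psi> \<in> test_functions \<Omega>"
  shows "integrable (lebesgue_on \<Omega>) (\<lambda>x. \<psi> x *\<^sub>R f x)"
proof (rule integrable_mult_compact_support[OF assms(1,2) test_function_continuous[OF assms(3)]
      test_function_support[OF assms(3)]])
  show "\<psi> x = 0" if "x \<notin> closure {x. \<psi> x \<noteq> 0}" for x
    using that closure_subset[of "{x. \<psi> x \<noteq> 0}"] by blast
qed

lemma test_function_partial_integrable:
  fixes f :: "'a::euclidean_space \<Rightarrow> 'b::euclidean_space"
  assumes "open \<Omega>" "locally_integrable \<Omega> f" "\<psi> \<in> test_functions \<Omega>" "b \<in> Basis"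
  shows "integrable (lebesgue_on \<Omega>) (\<lambda>x. frechet_derivative \<psi> (at x) b *\<^sub>R f x)"
  by (rule integrable_mult_compact_support[OF assms(1,2) test_function_partial_continuous[OF assms(3,4)]
      test_function_support[OF assms(3)] test_function_partial_support])

lemma locally_integrable_add:
  "locally_integrable \<Omega> f \<Longrightarrow> locally_integrable \<Omega> g \<Longrightarrow> locally_integrable \<Omega> (\<lambda>x. f x + g x)"
  by (simp add: locally_integrable_def set_integral_add(1))

lemma locally_integrable_scaleR:
  "locally_integrable \<Omega> f \<Longrightarrow> locally_integrable \<Omega> (\<lambda>x. c *\<^sub>R f x)"
  by (auto simp: locally_integrable_def)

lemma has_weak_gradient_add:
  assumes "open \<Omega>" "has_weak_gradient \<Omega> u g" "has_weak_gradient \<Omega> v h"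
  shows "has_weak_gradient \<Omega> (\<lambda>x. u x + v x) (\<lambda>x. g x + h x)"
proof -
  have loc: "locally_integrable \<Omega> u" "locally_integrable \<Omega> v" "locally_integrable \<Omega> g" "locally_integrable \<Omega> h"
    using assms by (auto simp: has_weak_gradient_def)
  have "(LINT x|lebesgue_on \<Omega>. (u x + v x) * frechet_derivative \<psi> (at x) b) =
      - (LINT x|lebesgue_on \<Omega>. ((g x + h x) \<bullet> b) * \<psi> x)"
    if "\<psi> \<in> test_functions \<Omega>" "b \<in> Basis" for \<psi> b
  proof -
    have *: "integrable (lebesgue_on \<Omega>) (\<lambda>x. f x * frechet_derivative \<psi> (at x) b)"
      if "locally_integrable \<Omega> f" for f
      using test_function_partial_integrable[OF assms(1) that \<open>\<psi> \<in> _\<close> \<open>b \<in> _\<close>] by (simp add: mult.commute)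
    have **: "integrable (lebesgue_on \<Omega>) (\<lambda>x. (f x \<bullet> b) * \<psi> x)" if "locally_integrable \<Omega> f" for f
      using integrable_inner_left[OF test_function_integrable[OF assms(1) that \<open>\<psi> \<in> _\<close>], of b]
      by (simp add: mult.commute)
    show ?thesis
      using assms(2,3) that loc by (simp add: has_weak_gradient_def inner_add_left distrib_right * **)
  qed
  with loc show ?thesis
    by (simp add: has_weak_gradient_def locally_integrable_add)
qed

lemma has_weak_gradient_scaleR:
  assumes "has_weak_gradient \<Omega> u g"
  shows "has_weak_gradient \<Omega> (\<lambda>x. c * u x) (\<lambda>x. c *\<^sub>R g x)"
  using assms locally_integrable_scaleR[of \<Omega> u c] locally_integrable_scaleR[of \<Omega> g c]
  by (simp add: has_weak_gradient_def mult.assoc)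

text \<open>Almost every point is a Lebesgue point with respect to the boxes \<open>cbox x (x + h *\<^sub>R One)\<close>. Inside a
  box contained in \<open>\<Omega>\<close> the averages over these small boxes all vanish, hence so does their limit \<open>w x\<close>;
  countably many boxes exhaust \<open>\<Omega>\<close>.\<close>

lemma AE_zero_of_integral_cbox_zero:
  fixes w :: "'a::euclidean_space \<Rightarrow> real"
  assumes "open \<Omega>" and loc: "locally_integrable \<Omega> w"
    and zero: "\<And>a b. cbox a b \<subseteq> \<Omega> \<Longrightarrow> integral (cbox a b) w = 0"
  shows "AE x in lebesgue_on \<Omega>. w x = 0"
proof -
  obtain \<D> where \<D>: "countable \<D>" "\<D> \<subseteq> Pow \<Omega>" "\<And>X. X \<in> \<D> \<Longrightarrow> \<exists>a b. X = cbox a b" "\<Union>\<D> = \<Omega>"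
    using open_countable_Union_open_cbox[OF \<open>open \<Omega>\<close>] by metis
  have "negligible {x \<in> X. w x \<noteq> 0}" if "X \<in> \<D>" for X
  proof -
    obtain a b where X: "X = cbox a b" and sub: "cbox a b \<subseteq> \<Omega>"
      using \<D> \<open>X \<in> \<D>\<close> by blast
    define F where "F = (\<lambda>x. if x \<in> cbox a b then w x else 0)"
    have "w integrable_on cbox a b"
      using loc sub unfolding locally_integrable_def
      by (auto intro: set_lebesgue_integral_eq_integral(1))
    then have "F integrable_on UNIV"
      unfolding F_def by (subst integrable_restrict_UNIV)
    then have "F integrable_on cbox c d" for c d
      by (rule integrable_on_subcbox) simp
    then obtain N where N: "negligible N"
      "\<And>x e. \<lbrakk>x \<notin> N; 0 < e\<rbrakk> \<Longrightarrow> \<exists>d>0. \<forall>h. 0 < h \<and> h < d \<longrightarrow>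
                  norm (integral (cbox x (x + h *\<^sub>R One)) F /\<^sub>R h ^ DIM('a) - F x) < e"
      using integrable_ccontinuous_explicit[of F] by blast
    have F0: "F x = 0" if x: "x \<in> box a b" "x \<notin> N" for x
    proof (rule ccontr)
      assume "F x \<noteq> 0"
      with N(2)[of x "\<bar>F x\<bar>"] x obtain d where d: "d > 0"
        "\<And>h. 0 < h \<Longrightarrow> h < d \<Longrightarrow>
           norm (integral (cbox x (x + h *\<^sub>R One)) F /\<^sub>R h ^ DIM('a) - F x) < \<bar>F x\<bar>"
        by auto
      have "((\<lambda>h. x + h *\<^sub>R One) \<longlongrightarrow> x + 0 *\<^sub>R One) (at_right 0)"
        by (intro tendsto_intros)
      then have "eventually (\<lambda>h. x + h *\<^sub>R One \<in> box a b) (at_right 0)"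
        using x by (intro topological_tendstoD[OF _ open_box]) simp_all
      moreover have "eventually (\<lambda>h. h \<in> {0<..<d}) (at_right (0::real))"
        using d(1) by (rule eventually_at_right_real)
      ultimately have "eventually (\<lambda>h. x + h *\<^sub>R One \<in> box a b \<and> h \<in> {0<..<d}) (at_right (0::real))"
        by (rule eventually_conj)
      then obtain h where h: "x + h *\<^sub>R One \<in> box a b" "0 < h" "h < d"
        by (auto dest!: eventually_happens simp: trivial_limit_at_right_real)
      then have le: "cbox x (x + h *\<^sub>R One) \<subseteq> cbox a b"
        using x by (intro subset_box_imp(1)) (simp add: mem_box less_imp_le)
      then have "integral (cbox x (x + h *\<^sub>R One)) F = integral (cbox x (x + h *\<^sub>R One)) w"
        by (intro integral_cong) (auto simp: F_def)
      also have "\<dots> = 0"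
        using le sub by (intro zero) simp
      finally show False
        using d(2)[OF h(2,3)] by simp
    qed
    have "{x \<in> X. w x \<noteq> 0} \<subseteq> N \<union> (cbox a b - box a b)"
    proof
      fix x assume "x \<in> {x \<in> X. w x \<noteq> 0}"
      then have "x \<in> cbox a b" "F x \<noteq> 0" by (auto simp: X F_def)
      then show "x \<in> N \<union> (cbox a b - box a b)" using F0 by blast
    qed
    then show ?thesis
      using N(1) negligible_frontier_interval negligible_Un negligible_subset by blast
  qed
  then have "negligible (\<Union>X\<in>\<D>. {x \<in> X. w x \<noteq> 0})"
    using \<D>(1) by (intro negligible_countable_Union) auto
  then have "{x \<in> \<Omega>. w x \<noteq> 0} \<in> null_sets lebesgue"
    unfolding \<D>(4)[symmetric] negligible_iff_null_sets[symmetric]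
    by (rule negligible_subset) auto
  then have "AE x in lebesgue. x \<in> \<Omega> \<longrightarrow> w x = 0"
    by (rule AE_I') auto
  then show ?thesis
    using \<open>open \<Omega>\<close> by (simp add: AE_restrict_space_iff)
qed

text \<open>The fundamental lemma of the calculus of variations: cut-off functions extend the class of test
  functions, by dominated convergence, to the indicators of boxes.\<close>

lemma AE_zero_of_test_functions:
  fixes w :: "'a::euclidean_space \<Rightarrow> real"
  assumes "open \<Omega>" and loc: "locally_integrable \<Omega> w"
    and zero: "\<And>\<psi>. \<psi> \<in> test_functions \<Omega> \<Longrightarrow> (LINT x|lebesgue_on \<Omega>. w x * \<psi> x) = 0"
  shows "AE x in lebesgue_on \<Omega>. w x = 0"
proof (rule AE_zero_of_integral_cbox_zero[OF assms(1,2)])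
  fix a c :: 'a assume sub: "cbox a c \<subseteq> \<Omega>"
  have meas: "\<Omega> \<in> sets lebesgue" using \<open>open \<Omega>\<close> by simp
  have cb: "w absolutely_integrable_on cbox a c"
    using loc sub by (simp add: locally_integrable_def)
  have b: "w absolutely_integrable_on box a c"
    by (rule set_integrable_subset[OF cb _ box_subset_cbox]) simp
  have ind: "indicat_real \<Omega> x * (f x * indicat_real B x) = indicat_real B x * f x" if "B \<subseteq> \<Omega>" for B f and x
    using that by (auto simp: indicator_def)
  have bsub: "box a c \<subseteq> \<Omega>" using sub box_subset_cbox by blast
  have int_box: "integrable (lebesgue_on \<Omega>) (\<lambda>x. w x * indicat_real (box a c) x)"
    using b meas by (simp add: integrable_restrict_space set_integrable_def ind[OF bsub])
  have int_cbox: "integrable (lebesgue_on \<Omega>) (\<lambda>x. \<bar>w x * indicat_real (cbox a c) x\<bar>)"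
    using cb meas by (intro integrable_abs) (simp add: integrable_restrict_space set_integrable_def ind[OF sub])
  have tf: "box_cutoff a c n \<in> test_functions \<Omega>" for n
    using box_cutoff_test_function[OF sub] .
  have int_n: "integrable (lebesgue_on \<Omega>) (\<lambda>x. w x * box_cutoff a c n x)" for n
    using test_function_integrable[OF \<open>open \<Omega>\<close> loc tf] by (simp add: mult.commute)
  have "(\<lambda>n. LINT x|lebesgue_on \<Omega>. w x * box_cutoff a c n x) \<longlonglongrightarrow>
      (LINT x|lebesgue_on \<Omega>. w x * indicat_real (box a c) x)"
  proof (rule integral_dominated_convergence[OF _ _ int_cbox])
    show "AE x in lebesgue_on \<Omega>. (\<lambda>n. w x * box_cutoff a c n x) \<longlonglongrightarrow> w x * indicat_real (box a c) x"
      by (intro AE_I2 tendsto_mult tendsto_const box_cutoff_tendsto)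
    show "AE x in lebesgue_on \<Omega>. norm (w x * box_cutoff a c n x) \<le> \<bar>w x * indicat_real (cbox a c) x\<bar>" for n
    proof (intro AE_I2)
      fix x
      show "norm (w x * box_cutoff a c n x) \<le> \<bar>w x * indicat_real (cbox a c) x\<bar>"
      proof (cases "x \<in> cbox a c")
        case True
        then show ?thesis
          using box_cutoff_bounds[of a c n x] by (simp add: abs_mult mult_left_le)
      next
        case False
        then have "box_cutoff a c n x = 0"
          using box_cutoff_nonzero_iff box_subset_cbox by blast
        then show ?thesis by simp
      qed
    qed
  qed (use int_box int_n in auto)
  then have "(LINT x|lebesgue_on \<Omega>. w x * indicat_real (box a c) x) = 0"
    unfolding zero[OF tf] by (simp add: LIMSEQ_const_iff)
  moreover have "(LINT x|lebesgue_on \<Omega>. w x * indicat_real (box a c) x) = integral (box a c) w"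
    using set_lebesgue_integral_eq_integral(2)[OF b] meas
    by (simp add: integral_restrict_space set_lebesgue_integral_def ind[OF bsub])
  ultimately show "integral (cbox a c) w = 0"
    by (simp add: integral_open_interval)
qed

lemma weak_gradient_AE_unique:
  assumes "open \<Omega>" "has_weak_gradient \<Omega> u g" "has_weak_gradient \<Omega> u h"
  shows "AE x in lebesgue_on \<Omega>. g x = h x"
proof -
  have loc: "locally_integrable \<Omega> g" "locally_integrable \<Omega> h"
    using assms by (auto simp: has_weak_gradient_def)
  have "AE x in lebesgue_on \<Omega>. (g x - h x) \<bullet> b = 0" if "b \<in> Basis" for b
  proof (rule AE_zero_of_test_functions[OF \<open>open \<Omega>\<close>])
    show "locally_integrable \<Omega> (\<lambda>x. (g x - h x) \<bullet> b)"
      using loc unfolding locally_integrable_def inner_diff_left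
      by (intro allI impI set_integral_diff(1) absolutely_integrable_component) auto
    fix \<psi> assume \<psi>: "\<psi> \<in> test_functions \<Omega>"
    have int: "integrable (lebesgue_on \<Omega>) (\<lambda>x. (f x \<bullet> b) * \<psi> x)" if "locally_integrable \<Omega> f" for f
      using integrable_inner_left[OF test_function_integrable[OF assms(1) that \<psi>], of b]
      by (simp add: mult.commute)
    have "(LINT x|lebesgue_on \<Omega>. (g x \<bullet> b) * \<psi> x) = (LINT x|lebesgue_on \<Omega>. (h x \<bullet> b) * \<psi> x)"
    proof -
      have "(LINT x|lebesgue_on \<Omega>. u x * frechet_derivative \<psi> (at x) b) = - (LINT x|lebesgue_on \<Omega>. (g x \<bullet> b) * \<psi> x)"
        "(LINT x|lebesgue_on \<Omega>. u x * frechet_derivative \<psi> (at x) b) = - (LINT x|lebesgue_on \<Omega>. (h x \<bullet> b) * \<psi> x)"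
        using assms(2,3) \<psi> that by (simp_all add: has_weak_gradient_def)
      then show ?thesis by simp
    qed
    then show "(LINT x|lebesgue_on \<Omega>. ((g x - h x) \<bullet> b) * \<psi> x) = 0"
      using loc by (simp add: inner_diff_left left_diff_distrib int)
  qed
  then have "AE x in lebesgue_on \<Omega>. \<forall>b\<in>Basis. (g x - h x) \<bullet> b = 0"
    by (intro AE_finite_allI) auto
  then show ?thesis
    by eventually_elim (metis euclidean_all_zero_iff right_minus_eq)
qed

section \<open>The Hahn-Banach theorem with a convex majorant\<close>

definition sublinear :: "('v::real_vector \<Rightarrow> real) \<Rightarrow> bool" where
  "sublinear p \<longleftrightarrow> (\<forall>x y. p (x + y) \<le> p x + p y) \<and> (\<forall>c\<ge>0. \<forall>x. p (c *\<^sub>R x) = c * p x)"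

lemma sublinear_add: "sublinear p \<Longrightarrow> p (x + y) \<le> p x + p y"
  and sublinear_scaleR: "sublinear p \<Longrightarrow> 0 \<le> c \<Longrightarrow> p (c *\<^sub>R x) = c * p x"
  by (auto simp: sublinear_def)

lemma sublinear_0: "sublinear p \<Longrightarrow> p 0 = 0"
  using sublinear_scaleR[of p 0 0] by simp

lemma sublinear_minus: "sublinear p \<Longrightarrow> - p (- x) \<le> p x"
  using sublinear_add[of p x "- x"] sublinear_0[of p] by simp

text \<open>The one construction behind all sublinear functionals below. Both conditions on \<open>F\<close> are inequalities
  for a suitable index \<open>k\<close>, so that a change of index can absorb a sum or a factor; applied to \<open>c\<close> and
  \<open>1/c\<close>, the second one yields homogeneity.\<close>

lemma sublinear_INF:
  fixes F :: "'i \<Rightarrow> 'v::real_vector \<Rightarrow> real"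
  assumes "I \<noteq> {}"
    and bdd: "\<And>i x. i \<in> I \<Longrightarrow> B x \<le> F i x"
    and add: "\<And>i j x y. i \<in> I \<Longrightarrow> j \<in> I \<Longrightarrow> \<exists>k\<in>I. F k (x + y) \<le> F i x + F j y"
    and scale: "\<And>i c x. i \<in> I \<Longrightarrow> 0 < c \<Longrightarrow> \<exists>k\<in>I. F k (c *\<^sub>R x) \<le> c * F i x"
  shows "sublinear (\<lambda>x. INF i\<in>I. F i x)"
proof -
  define u where "u x = (INF i\<in>I. F i x)" for x
  have lower: "u x \<le> F i x" if "i \<in> I" for i x
    unfolding u_def using that bdd by (intro cINF_lower bdd_belowI2)
  have greatest: "m \<le> u x" if "\<And>i. i \<in> I \<Longrightarrow> m \<le> F i x" for m x
    unfolding u_def using that \<open>I \<noteq> {}\<close> by (intro cINF_greatest)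
  have u_add: "u (x + y) \<le> u x + u y" for x y
  proof -
    have "u (x + y) - F j y \<le> F i x" if "i \<in> I" "j \<in> I" for i j
      using add[OF that, of x y] lower[of _ "x + y"] by (force simp: diff_le_eq intro: order_trans)
    then have "u (x + y) - F j y \<le> u x" if "j \<in> I" for j
      using that by (intro greatest)
    then have "u (x + y) - u x \<le> u y"
      by (intro greatest) (simp add: algebra_simps)
    then show ?thesis by simp
  qed
  have u_le: "u (c *\<^sub>R x) \<le> c * u x" if "0 < c" for c x
  proof -
    have "u (c *\<^sub>R x) / c \<le> u x"
    proof (rule greatest)
      fix i assume "i \<in> I"
      with scale[OF this that] lower have "u (c *\<^sub>R x) \<le> c * F i x"
        by (meson order_trans)
      with that show "u (c *\<^sub>R x) / c \<le> F i x"
        by (simp add: field_simps)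
    qed
    with that show ?thesis by (simp add: field_simps)
  qed
  have "u 0 = 0"
    using u_add[of 0 0] u_le[of "1/2" 0] by simp
  moreover have "u (c *\<^sub>R x) = c * u x" if "0 < c" for c x
    using u_le[OF that, of x] u_le[of "inverse c" "c *\<^sub>R x"] that
    by (simp add: field_simps)
  ultimately have "u (c *\<^sub>R x) = c * u x" if "0 \<le> c" for c x
    using that by (cases "c = 0") auto
  with u_add have "sublinear u" by (simp add: sublinear_def)
  then show ?thesis by (simp add: u_def[abs_def])
qed

text \<open>Lowering \<open>m\<close> as much as possible in direction \<open>y\<close> gives the sublinear functional
  \<open>inf\<^sub>t (m (x + t y) - t m(y))\<close>. By minimality it equals \<open>m\<close>, and \<open>t = 1\<close> gives superadditivity.\<close>

lemma linear_if_minimal_sublinear: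
  fixes m :: "'v::real_vector \<Rightarrow> real"
  assumes m: "sublinear m" and minimal: "\<And>q. sublinear q \<Longrightarrow> q \<le> m \<Longrightarrow> q = m"
  shows "linear m"
proof -
  have super: "m x + m y \<le> m (x + y)" for x y
  proof -
    define q where "q x = (INF t\<in>{0::real..}. m (x + t *\<^sub>R y) - t * m y)" for x
    have bdd: "- m (- x) \<le> m (x + t *\<^sub>R y) - t * m y" if "t \<in> {0..}" for x t
      using sublinear_add[OF m, of "x + t *\<^sub>R y" "- x"] sublinear_scaleR[OF m, of t y] that by simp
    have "sublinear q"
      unfolding q_def[abs_def]
    proof (rule sublinear_INF[where B = "\<lambda>x. - m (- x)"])
      fix s t :: real and x x' assume "s \<in> {0..}" "t \<in> {0..}"
      then show "\<exists>r\<in>{0..}. m (x + x' + r *\<^sub>R y) - r * m y \<le>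
          m (x + s *\<^sub>R y) - s * m y + (m (x' + t *\<^sub>R y) - t * m y)"
        using sublinear_add[OF m, of "x + s *\<^sub>R y" "x' + t *\<^sub>R y"]
        by (intro bexI[of _ "s + t"]) (auto simp: algebra_simps)
    next
      fix t c :: real and x assume "t \<in> {0..}" "0 < c"
      then show "\<exists>r\<in>{0..}. m (c *\<^sub>R x + r *\<^sub>R y) - r * m y \<le> c * (m (x + t *\<^sub>R y) - t * m y)"
        using sublinear_scaleR[OF m, of c "x + t *\<^sub>R y"]
        by (intro bexI[of _ "c * t"]) (auto simp: algebra_simps)
    qed (use bdd in auto)
    moreover have le: "q x \<le> m (x + t *\<^sub>R y) - t * m y" if "t \<in> {0..}" for x t
      unfolding q_def using that bdd by (intro cINF_lower bdd_belowI2)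
    then have "q \<le> m"
      by (force intro: le_funI dest: spec[of _ 0])
    ultimately have "q = m" by (rule minimal)
    with le[of 1 x] show ?thesis by simp
  qed
  have add: "m (x + y) = m x + m y" for x y
    using super[of x y] sublinear_add[OF m, of x y] by simp
  have neg: "m (- x) = - m x" for x
    using add[of x "- x"] sublinear_0[OF m] by simp
  have "m (c *\<^sub>R x) = c *\<^sub>R m x" for c x
  proof (cases "0 \<le> c")
    case True
    then show ?thesis using sublinear_scaleR[OF m] by simp
  next
    case False
    then show ?thesis
      using sublinear_scaleR[OF m, of "- c" x] neg[of "c *\<^sub>R x"] by simp
  qed
  with add show ?thesis by (rule linearI)
qed

lemma sublinear_dominates_linear:
  fixes p :: "'v::real_vector \<Rightarrow> real"
  assumes p: "sublinear p"
  obtains L where "linear L" "L \<le> p"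
proof -
  define A where "A = {q. sublinear q \<and> q \<le> p}"
  have "\<exists>m\<in>A. \<forall>a\<in>A. a \<le> m \<longrightarrow> a = m"
  proof (rule predicate_Zorn)
    show "partial_order_on A (relation_of (\<lambda>a b. b \<le> a) A)"
      by (rule partial_order_on_relation_ofI) auto
    fix C assume "C \<in> Chains (relation_of (\<lambda>a b. b \<le> a) A)"
    then have C: "C \<subseteq> A" and chain: "\<And>a b. a \<in> C \<Longrightarrow> b \<in> C \<Longrightarrow> a \<le> b \<or> b \<le> a"
      by (auto simp: Chains_def relation_of_def)
    show "\<exists>u\<in>A. \<forall>a\<in>C. u \<le> a"
    proof (cases "C = {}")
      case True
      then show ?thesis using p by (auto simp: A_def)
    next
      case False
      define u where "u x = (INF q\<in>C. q x)" for x
      have bdd: "- p (- x) \<le> q x" if "q \<in> C" for q x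
      proof -
        have "sublinear q" "q (- x) \<le> p (- x)"
          using that C by (auto simp: A_def le_fun_def)
        then show ?thesis using sublinear_minus[of q x] by linarith
      qed
      have sub: "sublinear q" if "q \<in> C" for q
        using that C by (auto simp: A_def)
      have "sublinear u"
        unfolding u_def[abs_def]
      proof (rule sublinear_INF[where B = "\<lambda>x. - p (- x)"])
        fix q r x y assume qr: "q \<in> C" "r \<in> C"
        from chain[OF this] show "\<exists>k\<in>C. k (x + y) \<le> q x + r y"
        proof
          assume "q \<le> r"
          with sublinear_add[OF sub[OF qr(1)], of x y] qr show ?thesis
            by (intro bexI[of _ q]) (auto simp: le_fun_def intro: order_trans)
        next
          assume "r \<le> q"
          with sublinear_add[OF sub[OF qr(2)], of x y] qr show ?thesis
            by (intro bexI[of _ r]) (auto simp: le_fun_def intro: order_trans)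
        qed
      next
        fix q c x assume "q \<in> C" "0 < (c::real)"
        then show "\<exists>k\<in>C. k (c *\<^sub>R x) \<le> c * q x"
          using sublinear_scaleR[OF sub, of q c x] by (intro bexI[of _ q]) auto
      qed (use False bdd in auto)
      moreover have lower: "\<forall>q\<in>C. u \<le> q"
        unfolding u_def le_fun_def using bdd by (auto intro!: cINF_lower bdd_belowI2)
      then have "u \<le> p"
        using False C by (force simp: A_def)
      ultimately show ?thesis using lower by (auto simp: A_def)
    qed
  qed
  then obtain m where "m \<in> A" "\<And>q. q \<in> A \<Longrightarrow> q \<le> m \<Longrightarrow> q = m" by blast
  then have "linear m" "m \<le> p"
    by (auto simp: A_def intro!: linear_if_minimal_sublinear intro: order_trans)
  then show thesis by (rule that)
qed

text \<open>The functional to be extended is given by its graph \<open>R\<close>; single-valuedness follows from the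
  majorant. The infimum of \<open>p (x - h) + c\<close> over \<open>(h, c) \<in> R\<close> is the largest sublinear functional below \<open>p\<close>
  that is at most \<open>c\<close> at each \<open>h\<close>, and a linear functional below it must agree with \<open>R\<close>.\<close>

lemma hahn_banach_sublinear:
  fixes p :: "'v::real_vector \<Rightarrow> real" and R :: "('v \<times> real) set"
  assumes p: "sublinear p" and R: "subspace R" and dom: "\<And>h c. (h, c) \<in> R \<Longrightarrow> c \<le> p h"
  obtains L where "linear L" "L \<le> p" "\<And>h c. (h, c) \<in> R \<Longrightarrow> L h = c"
proof -
  have R_minus: "(- h, - c) \<in> R" if "(h, c) \<in> R" for h c
    using subspace_neg[OF R that] by simp
  define q where "q x = (INF r\<in>R. p (x - fst r) + snd r)" for x
  have bdd: "- p (- x) \<le> p (x - fst r) + snd r" if "r \<in> R" for x r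
    using sublinear_add[OF p, of "x - fst r" "- x"] dom[OF R_minus, of "fst r" "snd r"] that by simp
  have "sublinear q"
    unfolding q_def[abs_def]
  proof (rule sublinear_INF[where B = "\<lambda>x. - p (- x)"])
    show "R \<noteq> {}" using subspace_0[OF R] by blast
    fix r s x y assume "r \<in> R" "s \<in> R"
    then show "\<exists>k\<in>R. p (x + y - fst k) + snd k \<le> p (x - fst r) + snd r + (p (y - fst s) + snd s)"
      using sublinear_add[OF p, of "x - fst r" "y - fst s"] subspace_add[OF R]
      by (intro bexI[of _ "r + s"]) (auto simp: algebra_simps)
  next
    fix r c x assume "r \<in> R" "0 < (c::real)"
    then show "\<exists>k\<in>R. p (c *\<^sub>R x - fst k) + snd k \<le> c * (p (x - fst r) + snd r)"
      using sublinear_scaleR[OF p, of c "x - fst r"] subspace_scale[OF R, of r c]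
      by (intro bexI[of _ "c *\<^sub>R r"]) (auto simp: algebra_simps)
  qed (rule bdd)
  then obtain L where L: "linear L" "L \<le> q" by (rule sublinear_dominates_linear)
  have lower: "q x \<le> p (x - h) + c" if "(h, c) \<in> R" for x h c
  proof -
    have "q x \<le> p (x - fst (h, c)) + snd (h, c)"
      unfolding q_def using that bdd by (intro cINF_lower bdd_belowI2)
    then show ?thesis by simp
  qed
  have "(0, 0) \<in> R" using subspace_0[OF R] by (simp add: zero_prod_def)
  from lower[OF this] have "q \<le> p" by (simp add: le_fun_def)
  have le: "L h \<le> c" if "(h, c) \<in> R" for h c
    using lower[OF that, of h] le_funD[OF L(2), of h] sublinear_0[OF p] by simp
  have "L h = c" if "(h, c) \<in> R" for h c
    using le[OF that] le[OF R_minus[OF that]] linear_neg[OF L(1), of h] by simp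
  then show thesis
    using that[OF L(1) order_trans[OF L(2) \<open>q \<le> p\<close>]] by blast
qed

text \<open>The infimum of the difference quotients \<open>\<Psi>(t x) / t\<close> is the directional derivative of \<open>\<Psi>\<close> at \<open>0\<close>. It is
  sublinear, lies below \<open>\<Psi>\<close>, and still majorises every
  linear functional that is below \<open>\<Psi>\<close> on a subspace.\<close>

lemma hahn_banach_convex_UNIV:
  fixes \<Psi> :: "'v::real_vector \<Rightarrow> real" and R :: "('v \<times> real) set"
  assumes cvx: "convex_on UNIV \<Psi>" and "\<Psi> 0 = 0"
    and R: "subspace R" and dom: "\<And>h c. (h, c) \<in> R \<Longrightarrow> c \<le> \<Psi> h"
  obtains L where "linear L" "L \<le> \<Psi>" "\<And>h c. (h, c) \<in> R \<Longrightarrow> L h = c"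
proof -
  have cvxD: "\<Psi> (u *\<^sub>R x + v *\<^sub>R y) \<le> u * \<Psi> x + v * \<Psi> y" if "0 \<le> u" "0 \<le> v" "u + v = 1" for u v x y
    using cvx that by (simp add: convex_on_def)
  define p where "p x = (INF t\<in>{0::real<..}. \<Psi> (t *\<^sub>R x) / t)" for x
  have bdd: "- \<Psi> (- x) \<le> \<Psi> (t *\<^sub>R x) / t" if "t \<in> {0<..}" for x t
  proof -
    have "\<Psi> ((1 / (1 + t)) *\<^sub>R (t *\<^sub>R x) + (t / (1 + t)) *\<^sub>R (- x)) \<le> (1 / (1 + t)) * \<Psi> (t *\<^sub>R x) + (t / (1 + t)) * \<Psi> (- x)"
      using that by (intro cvxD) (auto simp: field_simps)
    then have "0 \<le> (\<Psi> (t *\<^sub>R x) + t * \<Psi> (- x)) / (1 + t)"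
      using \<open>\<Psi> 0 = 0\<close> by (simp add: add_divide_distrib)
    then have "0 \<le> \<Psi> (t *\<^sub>R x) + t * \<Psi> (- x)"
      using that by (simp add: zero_le_divide_iff)
    with that show ?thesis by (simp add: field_simps)
  qed
  have "sublinear p"
    unfolding p_def[abs_def]
  proof (rule sublinear_INF[where B = "\<lambda>x. - \<Psi> (- x)"])
    fix s t :: real and x y assume st: "s \<in> {0<..}" "t \<in> {0<..}"
    \<comment> \<open>Half the harmonic mean: \<open>?r (x + y)\<close> is then a convex combination of \<open>s x\<close> and \<open>t y\<close>.\<close>
    let ?r = "s * t / (s + t)"
    have "\<Psi> ((t / (s + t)) *\<^sub>R (s *\<^sub>R x) + (s / (s + t)) *\<^sub>R (t *\<^sub>R y)) \<le> (t / (s + t)) * \<Psi> (s *\<^sub>R x) + (s / (s + t)) * \<Psi> (t *\<^sub>R y)"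
      using st by (intro cvxD) (auto simp: add_divide_distrib[symmetric] add.commute)
    moreover have "(t / (s + t)) *\<^sub>R (s *\<^sub>R x) + (s / (s + t)) *\<^sub>R (t *\<^sub>R y) = ?r *\<^sub>R (x + y)"
      by (simp add: scaleR_add_right mult.commute)
    moreover have "(t / (s + t)) * a + (s / (s + t)) * b = (a / s + b / t) * ?r" for a b
    proof -
      have "(a / s + b / t) * (s * t) = t * a + s * b"
        using st by (simp add: distrib_right)
      then show ?thesis
        by (simp add: add_divide_distrib)
    qed
    moreover have "0 < ?r" using st by simp
    ultimately have "\<Psi> (?r *\<^sub>R (x + y)) / ?r \<le> \<Psi> (s *\<^sub>R x) / s + \<Psi> (t *\<^sub>R y) / t"
      by (simp only: pos_divide_le_eq)
    then show "\<exists>r\<in>{0<..}. \<Psi> (r *\<^sub>R (x + y)) / r \<le> \<Psi> (s *\<^sub>R x) / s + \<Psi> (t *\<^sub>R y) / t"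
      using st by (intro bexI[of _ ?r]) auto
  next
    fix t c :: real and x assume "t \<in> {0<..}" "0 < c"
    then show "\<exists>r\<in>{0<..}. \<Psi> (r *\<^sub>R c *\<^sub>R x) / r \<le> c * (\<Psi> (t *\<^sub>R x) / t)"
      by (intro bexI[of _ "t / c"]) (auto simp: mult.commute)
  qed (use bdd in auto)
  moreover have "c \<le> p h" if "(h, c) \<in> R" for h c
    unfolding p_def
  proof (rule cINF_greatest)
    fix t :: real assume t: "t \<in> {0<..}"
    with dom[of "t *\<^sub>R h" "t * c"] subspace_scale[OF R that, of t] show "c \<le> \<Psi> (t *\<^sub>R h) / t"
      by (simp add: field_simps)
  qed auto
  ultimately obtain L where L: "linear L" "L \<le> p" "\<And>h c. (h, c) \<in> R \<Longrightarrow> L h = c"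
    using hahn_banach_sublinear[OF _ R] by blast
  have "p x \<le> \<Psi> (1 *\<^sub>R x) / 1" for x
    unfolding p_def using bdd by (intro cINF_lower bdd_belowI2) auto
  then have "p \<le> \<Psi>" by (simp add: le_fun_def)
  with L show thesis using that order_trans by blast
qed

text \<open>A linear projection onto \<open>X\<close> reduces a majorant on \<open>X\<close> to one on the whole space.\<close>

theorem hahn_banach_convex:
  fixes \<Psi> :: "'v::real_vector \<Rightarrow> real" and R :: "('v \<times> real) set"
  assumes X: "subspace X" and cvx: "convex_on X \<Psi>" and "\<Psi> 0 = 0"
    and R: "subspace R" and dom: "\<And>h c. (h, c) \<in> R \<Longrightarrow> h \<in> X \<and> c \<le> \<Psi> h"
  obtains L where "linear L" "\<And>x. x \<in> X \<Longrightarrow> L x \<le> \<Psi> x" "\<And>h c. (h, c) \<in> R \<Longrightarrow> L h = c"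
proof -
  obtain \<pi> :: "'v \<Rightarrow> 'v" where \<pi>: "range \<pi> \<subseteq> X" "linear \<pi>" "\<And>x. x \<in> X \<Longrightarrow> \<pi> x = x"
    using linear_exists_left_inverse_on[OF linear_id X] by auto
  have "convex_on UNIV (\<lambda>x. \<Psi> (\<pi> x))"
  proof (rule convex_onI)
    fix t :: real and x y :: 'v assume "0 < t" "t < 1"
    moreover have "\<pi> ((1 - t) *\<^sub>R x + t *\<^sub>R y) = (1 - t) *\<^sub>R \<pi> x + t *\<^sub>R \<pi> y"
      using \<pi>(2) by (simp add: linear_add linear_scale)
    ultimately show "\<Psi> (\<pi> ((1 - t) *\<^sub>R x + t *\<^sub>R y)) \<le> (1 - t) * \<Psi> (\<pi> x) + t * \<Psi> (\<pi> y)"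
      using \<pi>(1) convex_onD[OF cvx, of t "\<pi> x" "\<pi> y"] by auto
  qed simp
  moreover have "\<Psi> (\<pi> 0) = 0"
    using \<pi>(2) assms(3) by (simp add: linear_0)
  moreover have "c \<le> \<Psi> (\<pi> h)" if "(h, c) \<in> R" for h c
    using dom[OF that] \<pi>(3) by simp
  ultimately obtain L where "linear L" "L \<le> (\<lambda>x. \<Psi> (\<pi> x))" "\<And>h c. (h, c) \<in> R \<Longrightarrow> L h = c"
    using hahn_banach_convex_UNIV[OF _ _ R] by blast
  with \<pi>(3) show thesis
    by (intro that[of L]) (auto simp: le_fun_def, metis)
qed

section \<open>Charges with a dominating density\<close>

text \<open>Adding the indefinite integral of \<open>k\<close> makes \<open>\<nu>\<close> nonnegative, and domination by \<open>2k\<close> makes the sum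
  countably additive and absolutely continuous, so it has a Radon-Nikodym density.\<close>

lemma (in sigma_finite_measure) dominated_charge_density:
  fixes \<nu> :: "'a set \<Rightarrow> real"
  assumes add: "\<And>E F. E \<in> sets M \<Longrightarrow> F \<in> sets M \<Longrightarrow> E \<inter> F = {} \<Longrightarrow> \<nu> (E \<union> F) = \<nu> E + \<nu> F"
    and k: "integrable M k"
    and bound: "\<And>E. E \<in> sets M \<Longrightarrow> \<bar>\<nu> E\<bar> \<le> (LINT x:E|M. k x)"
  obtains f where "integrable M f" "\<And>E. E \<in> sets M \<Longrightarrow> \<nu> E = (LINT x:E|M. f x)"
proof -
  have ki: "set_integrable M E k" if "E \<in> sets M" for E
    unfolding set_integrable_def by (rule integrable_mult_indicator[OF that k])
  define \<mu> where "\<mu> E = \<nu> E + (LINT x:E|M. k x)" for E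
  have \<mu>_bounds: "0 \<le> \<mu> E" "\<mu> E \<le> 2 * (LINT x:E|M. k x)" if "E \<in> sets M" for E
    using bound[OF that] by (auto simp: \<mu>_def)
  have \<mu>_add: "\<mu> (E \<union> F) = \<mu> E + \<mu> F" if "E \<in> sets M" "F \<in> sets M" "E \<inter> F = {}" for E F
    using add[OF that] set_integral_Un[OF that(3) ki[OF that(1)] ki[OF that(2)]]
    by (simp add: \<mu>_def)
  have \<mu>_null: "\<mu> E = 0" if "E \<in> sets M" "(LINT x:E|M. k x) = 0" for E
    using \<mu>_bounds[OF that(1)] that(2) by simp
  define N where "N = measure_of (space M) (sets M) (\<lambda>E. ennreal (\<mu> E))"
  have [simp]: "space N = space M" "sets N = sets M"
    by (simp_all add: N_def)
  have emeasure_N: "emeasure N E = ennreal (\<mu> E)" if "E \<in> sets M" for E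
  proof (rule emeasure_measure_of[OF N_def])
    show "positive (sets N) (\<lambda>E. ennreal (\<mu> E))"
      by (simp add: positive_def \<mu>_null set_lebesgue_integral_def)
    show "countably_additive (sets N) (\<lambda>E. ennreal (\<mu> E))"
      unfolding \<open>sets N = sets M\<close>
    \<comment> \<open>For a finitely additive finite set function, continuity at the empty set is enough.\<close>
    proof (rule sets.empty_continuous_imp_countably_additive)
      show "positive (sets M) (\<lambda>E. ennreal (\<mu> E))"
        by (simp add: positive_def \<mu>_null set_lebesgue_integral_def)
      show "additive (sets M) (\<lambda>E. ennreal (\<mu> E))"
        by (auto simp: additive_def \<mu>_add \<mu>_bounds simp flip: ennreal_plus)
      fix A :: "nat \<Rightarrow> 'a set"
      assume A: "range A \<subseteq> sets M" "decseq A" "(\<Inter>i. A i) = {}"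
      have "(\<lambda>i. LINT x:A i|M. k x) \<longlonglongrightarrow> (LINT x:(\<Inter>i. A i)|M. k x)"
        using A by (intro set_integral_cont_down ki) auto
      then have lim: "(\<lambda>i. 2 * (LINT x:A i|M. k x)) \<longlonglongrightarrow> 0"
        using A(3) by (auto simp: set_lebesgue_integral_def intro: tendsto_mult_right_zero)
      have "(\<lambda>i. \<mu> (A i)) \<longlonglongrightarrow> 0"
        by (rule tendsto_sandwich[OF _ _ tendsto_const lim])
          (use A(1) in \<open>auto intro!: always_eventually \<mu>_bounds\<close>)
      then show "(\<lambda>i. ennreal (\<mu> (A i))) \<longlonglongrightarrow> 0"
        using tendsto_ennrealI by fastforce
    qed auto
  qed (use that sets.space_closed in auto)
  have "absolutely_continuous M N"
    unfolding absolutely_continuous_def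
  proof
    fix E assume E: "E \<in> null_sets M"
    then have "AE x in M. x \<notin> E"
      using AE_not_in by blast
    then have "AE x in M. indicat_real E x *\<^sub>R k x = 0"
      by eventually_elim simp
    then have "(LINT x:E|M. k x) = 0"
      unfolding set_lebesgue_integral_def by (rule integral_eq_zero_AE)
    with E show "E \<in> null_sets N"
      by (auto simp: null_sets_def emeasure_N \<mu>_null)
  qed
  then obtain f where f: "f \<in> borel_measurable M" "density M f = N"
    using Radon_Nikodym[of N] by auto
  have f_int: "(\<integral>\<^sup>+x. f x * indicator E x \<partial>M) = ennreal (\<mu> E)" if "E \<in> sets M" for E
    using emeasure_density[OF f(1) that] f(2) emeasure_N[OF that] by simp
  have "(\<integral>\<^sup>+x. f x \<partial>M) = (\<integral>\<^sup>+x. f x * indicator (space M) x \<partial>M)"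
    by (intro nn_integral_cong) simp
  then have "(\<integral>\<^sup>+x. f x \<partial>M) \<noteq> \<infinity>"
    using f_int[of "space M"] by simp
  then have "AE x in M. f x \<noteq> \<infinity>"
    using f(1) nn_integral_PInf_AE by blast
  then have f_real: "AE x in M. f x = ennreal (enn2real (f x))"
    by eventually_elim (simp add: top.not_eq_extremum)
  have f_bochner: "has_bochner_integral M (\<lambda>x. indicat_real E x *\<^sub>R enn2real (f x)) (\<mu> E)"
    if "E \<in> sets M" for E
  proof (rule has_bochner_integral_nn_integral)
    have "(\<integral>\<^sup>+x. ennreal (indicat_real E x *\<^sub>R enn2real (f x)) \<partial>M) = (\<integral>\<^sup>+x. f x * indicator E x \<partial>M)"
      using f_real by (intro nn_integral_cong_AE, eventually_elim) (auto split: split_indicator)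
    then show "(\<integral>\<^sup>+x. ennreal (indicat_real E x *\<^sub>R enn2real (f x)) \<partial>M) = ennreal (\<mu> E)"
      using f_int[OF that] by simp
  qed (use f that \<mu>_bounds in auto)
  have "integrable M (\<lambda>x. indicat_real (space M) x *\<^sub>R enn2real (f x)) \<longleftrightarrow> integrable M (\<lambda>x. enn2real (f x))"
    by (rule Bochner_Integration.integrable_cong) simp_all
  then have f_integrable: "integrable M (\<lambda>x. enn2real (f x))"
    using f_bochner[OF sets.top] by (simp only: has_bochner_integral_iff)
  show thesis
  proof (rule that)
    show "integrable M (\<lambda>x. enn2real (f x) - k x)"
      by (rule Bochner_Integration.integrable_diff[OF f_integrable k])
    fix E assume E: "E \<in> sets M"
    have "(LINT x:E|M. enn2real (f x) - k x) = \<mu> E - (LINT x:E|M. k x)"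
      using f_bochner[OF E] ki[OF E]
      by (subst set_integral_diff) (auto simp: has_bochner_integral_iff set_integrable_def set_lebesgue_integral_def)
    then show "\<nu> E = (LINT x:E|M. enn2real (f x) - k x)"
      by (simp add: \<mu>_def)
  qed
qed

lemma AE_le_of_set_integral_le:
  fixes f g :: "'a \<Rightarrow> real"
  assumes f: "integrable M f" and g: "integrable M g"
    and le: "\<And>E. E \<in> sets M \<Longrightarrow> (LINT x:E|M. f x) \<le> (LINT x:E|M. g x)"
  shows "AE x in M. f x \<le> g x"
proof -
  note [measurable] = borel_measurable_integrable[OF f] borel_measurable_integrable[OF g]
  define E where "E = {x \<in> space M. g x < f x}"
  have E[measurable]: "E \<in> sets M" by (simp add: E_def)
  have int: "integrable M (\<lambda>x. indicat_real E x *\<^sub>R f x)" "integrable M (\<lambda>x. indicat_real E x *\<^sub>R g x)"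
    by (rule integrable_mult_indicator[OF E f], rule integrable_mult_indicator[OF E g])
  let ?d = "\<lambda>x. indicat_real E x * (f x - g x)"
  have nonneg: "AE x in M. 0 \<le> ?d x"
    by (intro AE_I2) (auto simp: E_def split: split_indicator)
  have d: "integrable M ?d"
    using Bochner_Integration.integrable_diff[OF int] by (simp add: right_diff_distrib)
  have "(LINT x|M. ?d x) = (LINT x:E|M. f x) - (LINT x:E|M. g x)"
    using Bochner_Integration.integral_diff[OF int] by (simp add: right_diff_distrib set_lebesgue_integral_def)
  then have "(LINT x|M. ?d x) = 0"
    using le[OF E] integral_nonneg_AE[OF nonneg] by simp
  then have "AE x in M. ?d x = 0"
    using integral_nonneg_eq_0_iff_AE[OF d nonneg] by simp
  with AE_space show ?thesis
    by eventually_elim (auto simp: E_def split: split_indicator_asm)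
qed

section \<open>Square-integrable functions\<close>

text \<open>Pointwise operations turn functions into a real vector space, in which the square-integrable functions
  are a subspace; Hahn-Banach is applied there, with representatives instead of a.e.-classes.\<close>

instantiation "fun" :: (type, scaleR) scaleR
begin
definition "r *\<^sub>R f = (\<lambda>x. r *\<^sub>R f x)"
instance ..
end

instance "fun" :: (type, real_vector) real_vector
  by standard (simp_all add: scaleR_fun_def fun_eq_iff scaleR_add_right scaleR_add_left)

lemma fun_scaleR_apply [simp]: "(r *\<^sub>R f) x = r *\<^sub>R f x"
  by (simp add: scaleR_fun_def)

lemma fun_sum_apply [simp]: "(\<Sum>i\<in>I. f i) x = (\<Sum>i\<in>I. f i x)"
  by (induction I rule: infinite_finite_induct) auto

definition square_integrable :: "'a measure \<Rightarrow> ('a \<Rightarrow> 'b::euclidean_space) \<Rightarrow> bool" where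
  "square_integrable M f \<longleftrightarrow> f \<in> borel_measurable M \<and> integrable M (\<lambda>x. (norm (f x))\<^sup>2)"

lemma square_integrable_bound:
  assumes "f \<in> borel_measurable M" "integrable M k" "AE x in M. (norm (f x))\<^sup>2 \<le> k x"
  shows "square_integrable M f"
proof -
  have "integrable M (\<lambda>x. (norm (f x))\<^sup>2)"
    using assms(1) by (intro Bochner_Integration.integrable_bound[OF assms(2)])
      (use assms(3) in \<open>auto elim!: eventually_mono\<close>)
  with assms(1) show ?thesis by (simp add: square_integrable_def)
qed

lemma norm_add_squared_le: "(norm (x + y))\<^sup>2 \<le> 2 * (norm x)\<^sup>2 + 2 * (norm y)\<^sup>2"
  for x y :: "'a::real_normed_vector"
proof -
  have "(norm (x + y))\<^sup>2 \<le> (norm x + norm y)\<^sup>2"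
    by (intro power_mono norm_triangle_ineq) simp
  also have "\<dots> \<le> 2 * (norm x)\<^sup>2 + 2 * (norm y)\<^sup>2"
    using sum_squares_bound[of "norm x" "norm y"] by (simp add: power2_sum)
  finally show ?thesis .
qed

lemma square_integrable_add:
  "square_integrable M f \<Longrightarrow> square_integrable M g \<Longrightarrow> square_integrable M (\<lambda>x. f x + g x)"
  by (intro square_integrable_bound[where k="\<lambda>x. 2 * (norm (f x))\<^sup>2 + 2 * (norm (g x))\<^sup>2"])
    (auto simp: square_integrable_def norm_add_squared_le)

lemma square_integrable_scaleR:
  "square_integrable M f \<Longrightarrow> square_integrable M (\<lambda>x. c *\<^sub>R f x)"
  by (auto simp: square_integrable_def power_mult_distrib)

lemma square_integrable_diff:
  "square_integrable M f \<Longrightarrow> square_integrable M g \<Longrightarrow> square_integrable M (\<lambda>x. f x - g x)"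
  using square_integrable_add[of M f "\<lambda>x. - 1 *\<^sub>R g x"] square_integrable_scaleR[of M g "- 1"] by simp

lemma subspace_square_integrable:
  "subspace {f :: 'a \<Rightarrow> 'b::euclidean_space. square_integrable M f}"
  unfolding subspace_def
  by (auto simp: plus_fun_def scaleR_fun_def square_integrable_add square_integrable_scaleR)
    (simp add: square_integrable_def zero_fun_def)

lemma square_integrable_inner:
  assumes "square_integrable M f" "square_integrable M g"
  shows "integrable M (\<lambda>x. f x \<bullet> g x)"
proof (rule Bochner_Integration.integrable_bound)
  show "integrable M (\<lambda>x. (norm (f x))\<^sup>2 + (norm (g x))\<^sup>2)"
    using assms by (auto simp: square_integrable_def)
  have "\<bar>f x \<bullet> g x\<bar> \<le> (norm (f x))\<^sup>2 + (norm (g x))\<^sup>2" for x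
    using Cauchy_Schwarz_ineq2[of "f x" "g x"] sum_squares_bound[of "norm (f x)" "norm (g x)"]
      mult_nonneg_nonneg[of "norm (f x)" "norm (g x)"] by simp
  then show "AE x in M. norm (f x \<bullet> g x) \<le> norm ((norm (f x))\<^sup>2 + (norm (g x))\<^sup>2)"
    by (intro AE_I2) (auto intro: order_trans[OF _ abs_ge_self])
qed (use assms in \<open>auto simp: square_integrable_def\<close>)

section \<open>Subgradients of convex integral functionals\<close>

text \<open>Test the subgradient inequality at \<open>p + t \<xi>\<close>: the left side is \<open>t |\<xi>|\<^sup>2\<close>, the right side at most
  \<open>3 C |p|\<^sup>2 + 2 C t\<^sup>2 |\<xi>|\<^sup>2\<close>. The choice \<open>t = 1/(4C)\<close> lets half of the left side absorb the last term.\<close>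

lemma subdiff_norm_bound:
  assumes bound: "\<And>q. \<bar>A q\<bar> \<le> C * (norm q)\<^sup>2" and "C > 0" and \<xi>: "\<xi> \<in> subdiff A p"
  shows "(norm \<xi>)\<^sup>2 \<le> 24 * C\<^sup>2 * (norm p)\<^sup>2"
proof -
  let ?t = "1 / (4 * C)"
  have sub: "\<xi> \<bullet> (r - p) \<le> A r - A p" for r
    using \<xi> by (simp add: subdiff_def)
  have "?t * (norm \<xi>)\<^sup>2 = \<xi> \<bullet> ((p + ?t *\<^sub>R \<xi>) - p)"
    by (simp add: power2_norm_eq_inner)
  also have "\<dots> \<le> A (p + ?t *\<^sub>R \<xi>) - A p"
    by (rule sub)
  also have "\<dots> \<le> C * (norm (p + ?t *\<^sub>R \<xi>))\<^sup>2 + C * (norm p)\<^sup>2"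
    using bound[of "p + ?t *\<^sub>R \<xi>"] bound[of p] by linarith
  also have "\<dots> \<le> C * (2 * (norm p)\<^sup>2 + 2 * (norm (?t *\<^sub>R \<xi>))\<^sup>2) + C * (norm p)\<^sup>2"
    using norm_add_squared_le[of p "?t *\<^sub>R \<xi>"] \<open>C > 0\<close> by simp
  also have "\<dots> = 3 * C * (norm p)\<^sup>2 + (norm \<xi>)\<^sup>2 / (8 * C)"
    using \<open>C > 0\<close> by (simp add: field_simps power2_eq_square)
  finally show ?thesis
    using \<open>C > 0\<close> by (simp add: field_simps power2_eq_square)
qed

definition integral_increment ::
    "'a measure \<Rightarrow> ('b::euclidean_space \<Rightarrow> real) \<Rightarrow> ('a \<Rightarrow> 'b) \<Rightarrow> ('a \<Rightarrow> 'b) \<Rightarrow> real" where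
  "integral_increment M A g h = (LINT x|M. A (g x + h x) - A (g x))"

context
  fixes M :: "'a measure" and A :: "'b::euclidean_space \<Rightarrow> real" and C :: real
  assumes M: "finite_measure M"
    and C_pos: "C > 0" and bound: "\<And>q. \<bar>A q\<bar> \<le> C * (norm q)\<^sup>2"
    and convex: "convex_on UNIV A"
begin

lemma density_continuous: "continuous_on UNIV A"
  using convex by (rule convex_on_continuous[OF open_UNIV])

lemma density_measurable [measurable]: "A \<in> borel_measurable borel"
  using density_continuous by (rule borel_measurable_continuous_onI)

lemma integrable_A:
  assumes "square_integrable M f"
  shows "integrable M (\<lambda>x. A (f x))"
proof (rule Bochner_Integration.integrable_bound)
  show "integrable M (\<lambda>x. C * (norm (f x))\<^sup>2)" "(\<lambda>x. A (f x)) \<in> borel_measurable M"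
    using assms by (auto simp: square_integrable_def)
  show "AE x in M. norm (A (f x)) \<le> norm (C * (norm (f x))\<^sup>2)"
    using bound C_pos by (intro AE_I2) (simp add: abs_mult)
qed

lemma integrable_increment:
  "square_integrable M g \<Longrightarrow> square_integrable M h \<Longrightarrow> integrable M (\<lambda>x. A (g x + h x) - A (g x))"
  by (intro Bochner_Integration.integrable_diff integrable_A square_integrable_add)

lemma convex_integral_increment:
  assumes g: "square_integrable M g"
  shows "convex_on {h. square_integrable M h} (integral_increment M A g)"
proof (rule convex_onI)
  show "convex {h :: 'a \<Rightarrow> 'b. square_integrable M h}"
    by (rule subspace_imp_convex[OF subspace_square_integrable])
  fix t :: real and h k :: "'a \<Rightarrow> 'b" assume t: "0 < t" "t < 1"
    and "h \<in> {h. square_integrable M h}" "k \<in> {h. square_integrable M h}"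
  then have h: "square_integrable M h" and k: "square_integrable M k" by auto
  have "integral_increment M A g ((1 - t) *\<^sub>R h + t *\<^sub>R k)
      \<le> (LINT x|M. (1 - t) * (A (g x + h x) - A (g x)) + t * (A (g x + k x) - A (g x)))"
    unfolding integral_increment_def
  proof (rule integral_mono)
    show "integrable M (\<lambda>x. A (g x + ((1 - t) *\<^sub>R h + t *\<^sub>R k) x) - A (g x))"
      using integrable_increment[OF g square_integrable_add[OF square_integrable_scaleR[OF h] square_integrable_scaleR[OF k]]]
      by simp
    show "integrable M (\<lambda>x. (1 - t) * (A (g x + h x) - A (g x)) + t * (A (g x + k x) - A (g x)))"
      using integrable_increment[OF g] h k by simp
    fix x
    have "A (g x + ((1 - t) *\<^sub>R h x + t *\<^sub>R k x)) = A ((1 - t) *\<^sub>R (g x + h x) + t *\<^sub>R (g x + k x))"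
      by (simp add: algebra_simps)
    also have "\<dots> \<le> (1 - t) * A (g x + h x) + t * A (g x + k x)"
      using t by (intro convex_onD[OF convex]) auto
    finally show "A (g x + ((1 - t) *\<^sub>R h + t *\<^sub>R k) x) - A (g x)
        \<le> (1 - t) * (A (g x + h x) - A (g x)) + t * (A (g x + k x) - A (g x))"
      by (simp add: algebra_simps)
  qed
  also have "\<dots> = (1 - t) * integral_increment M A g h + t * integral_increment M A g k"
    using integrable_increment[OF g] h k by (simp add: integral_increment_def)
  finally show "integral_increment M A g ((1 - t) *\<^sub>R h + t *\<^sub>R k) \<le> (1 - t) * integral_increment M A g h + t * integral_increment M A g k" .
qed

lemma square_integrable_indicator_scaleR:
  assumes "E \<in> sets M"
  shows "square_integrable M (\<lambda>x. indicat_real E x *\<^sub>R q)"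
proof (rule square_integrable_bound[where k="\<lambda>_. (norm q)\<^sup>2"])
  show "integrable M (\<lambda>_. (norm q)\<^sup>2)"
    using M by (simp add: finite_measure.integrable_const)
qed (use assms in \<open>auto split: split_indicator\<close>)

lemma increment_indicator:
  "integral_increment M A g (\<lambda>x. indicat_real E x *\<^sub>R q) = (LINT x:E|M. A (g x + q) - A (g x))"
  unfolding integral_increment_def set_lebesgue_integral_def
  by (intro Bochner_Integration.integral_cong) (auto split: split_indicator)

lemma square_integrable_const: "square_integrable M (\<lambda>x. q :: 'b)"
  using M by (simp add: square_integrable_def finite_measure.integrable_const)

context
  fixes g :: "'a \<Rightarrow> 'b" and L :: "('a \<Rightarrow> 'b) \<Rightarrow> real"
  assumes g: "square_integrable M g" and L: "linear L"
    and L_le: "\<And>h. square_integrable M h \<Longrightarrow> L h \<le> integral_increment M A g h"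
begin

text \<open>The increment vanishes at \<open>h\<close> and \<open>-h\<close>. In particular \<open>L\<close> does not see the values outside the space of \<open>M\<close>.\<close>

lemma majorised_functional_null:
  assumes h: "h \<in> borel_measurable M" and null: "AE x in M. h x = 0"
  shows "L h = 0"
proof -
  have *: "L k \<le> 0" if k: "k \<in> borel_measurable M" "AE x in M. k x = 0" for k
  proof -
    have "square_integrable M k"
      by (rule square_integrable_bound[where k="\<lambda>_. 0"]) (use k in auto)
    then have "L k \<le> integral_increment M A g k" by (rule L_le)
    also have "\<dots> = 0"
      unfolding integral_increment_def using k(2) by (intro integral_eq_zero_AE) (auto elim: eventually_mono)
    finally show ?thesis .
  qed
  have "L (- h) \<le> 0"
    using h null by (intro *) (auto simp: fun_Compl_def)
  then show ?thesis
    using *[OF h null] by (simp add: linear_neg[OF L])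
qed

text \<open>The increments of \<open>A\<close> in directions \<open>q\<close> and \<open>-q\<close> bound \<open>L(1\<^sub>E q)\<close> from above and below, so this charge has
  a density; the densities for the basis vectors \<open>q\<close> are the components of \<open>\<xi>\<close>.\<close>

lemma majorised_functional_indicator:
  obtains \<xi> where "\<xi> \<in> borel_measurable M"
    "\<And>q. integrable M (\<lambda>x. \<xi> x \<bullet> q)"
    "\<And>E q. E \<in> sets M \<Longrightarrow> L (\<lambda>x. indicat_real E x *\<^sub>R q) = (LINT x:E|M. \<xi> x \<bullet> q)"
proof -
  have "\<exists>f. integrable M f \<and> (\<forall>E\<in>sets M. L (\<lambda>x. indicat_real E x *\<^sub>R q) = (LINT x:E|M. f x))" for q
  proof -
    let ?k = "\<lambda>q x. A (g x + q) - A (g x)"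
    have k: "integrable M (?k q)" for q
      by (rule integrable_increment[OF g square_integrable_const])
    have ki: "set_integrable M E (?k q)" if "E \<in> sets M" for E q
      unfolding set_integrable_def by (rule integrable_mult_indicator[OF that k])
    have ki': "set_integrable M E (\<lambda>x. \<bar>?k q x\<bar>)" if "E \<in> sets M" for E q
      by (rule set_integrable_abs[OF ki[OF that]])
    have le: "L (\<lambda>x. indicat_real E x *\<^sub>R q) \<le> (LINT x:E|M. \<bar>?k q x\<bar>)" if "E \<in> sets M" for E q
    proof -
      have "L (\<lambda>x. indicat_real E x *\<^sub>R q) \<le> (LINT x:E|M. ?k q x)"
        using L_le[OF square_integrable_indicator_scaleR[OF that]] by (simp add: increment_indicator)
      also have "\<dots> \<le> (LINT x:E|M. \<bar>?k q x\<bar>)"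
        by (rule set_integral_mono[OF ki[OF that] ki'[OF that]]) simp
      finally show ?thesis .
    qed
    obtain f where "integrable M f"
      "\<And>E. E \<in> sets M \<Longrightarrow> L (\<lambda>x. indicat_real E x *\<^sub>R q) = (LINT x:E|M. f x)"
    proof (rule sigma_finite_measure.dominated_charge_density
        [of M "\<lambda>E. L (\<lambda>x. indicat_real E x *\<^sub>R q)" "\<lambda>x. \<bar>?k q x\<bar> + \<bar>?k (- q) x\<bar>"])
      show "sigma_finite_measure M"
        using M by (rule finite_measure.axioms(1))
      show "L (\<lambda>x. indicat_real (E \<union> F) x *\<^sub>R q) =
          L (\<lambda>x. indicat_real E x *\<^sub>R q) + L (\<lambda>x. indicat_real F x *\<^sub>R q)" if "E \<inter> F = {}" for E F
      proof -
        have "(\<lambda>x. indicat_real (E \<union> F) x *\<^sub>R q) =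
            (\<lambda>x. indicat_real E x *\<^sub>R q) + (\<lambda>x. indicat_real F x *\<^sub>R q)"
          using that by (auto simp: fun_eq_iff split: split_indicator)
        then show ?thesis using linear_add[OF L] by simp
      qed
      show "integrable M (\<lambda>x. \<bar>?k q x\<bar> + \<bar>?k (- q) x\<bar>)"
        by (intro Bochner_Integration.integrable_add integrable_abs k)
      show "\<bar>L (\<lambda>x. indicat_real E x *\<^sub>R q)\<bar> \<le> (LINT x:E|M. \<bar>?k q x\<bar> + \<bar>?k (- q) x\<bar>)"
        if E: "E \<in> sets M" for E
      proof -
        have "(\<lambda>x. indicat_real E x *\<^sub>R - q) = - (\<lambda>x. indicat_real E x *\<^sub>R q)"
          by (simp add: fun_eq_iff)
        then have "- L (\<lambda>x. indicat_real E x *\<^sub>R q) \<le> (LINT x:E|M. \<bar>?k (- q) x\<bar>)"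
          using le[OF E, of "- q"] linear_neg[OF L, of "\<lambda>x. indicat_real E x *\<^sub>R q"] by simp
        moreover have "0 \<le> (LINT x:E|M. \<bar>?k q x\<bar>)" "0 \<le> (LINT x:E|M. \<bar>?k (- q) x\<bar>)"
          unfolding set_lebesgue_integral_def by (intro Bochner_Integration.integral_nonneg; simp)+
        ultimately show ?thesis
          using le[OF E, of q] set_integral_add(2)[OF ki'[OF E, of q] ki'[OF E, of "- q"]]
          unfolding abs_le_iff by linarith
      qed
    qed blast
    then show ?thesis by blast
  qed
  then obtain f where f: "\<And>q. integrable M (f q)"
    "\<And>E q. E \<in> sets M \<Longrightarrow> L (\<lambda>x. indicat_real E x *\<^sub>R q) = (LINT x:E|M. f q x)"
    by metis
  define \<xi> where "\<xi> x = (\<Sum>b\<in>Basis. f b x *\<^sub>R b)" for x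
  have inner: "\<xi> x \<bullet> q = (\<Sum>b\<in>Basis. (q \<bullet> b) * f b x)" for x q
    by (simp add: \<xi>_def inner_sum_left inner_commute[of q] mult.commute)
  show thesis
  proof (rule that[of \<xi>])
    show "\<xi> \<in> borel_measurable M"
      unfolding \<xi>_def[abs_def] using f(1) by (auto intro!: borel_measurable_sum borel_measurable_scaleR)
    show "integrable M (\<lambda>x. \<xi> x \<bullet> q)" for q
      unfolding inner using f(1) by simp
    fix E and q :: 'b assume E: "E \<in> sets M"
    have "(\<lambda>x. indicat_real E x *\<^sub>R q) = (\<Sum>b\<in>Basis. (q \<bullet> b) *\<^sub>R (\<lambda>x. indicat_real E x *\<^sub>R b))"
    proof (rule ext)
      fix x
      have "indicat_real E x *\<^sub>R q = indicat_real E x *\<^sub>R (\<Sum>b\<in>Basis. (q \<bullet> b) *\<^sub>R b)"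
        by (simp only: euclidean_representation)
      then show "indicat_real E x *\<^sub>R q = (\<Sum>b\<in>Basis. (q \<bullet> b) *\<^sub>R (\<lambda>x. indicat_real E x *\<^sub>R b)) x"
        by (simp add: scaleR_sum_right mult.commute)
    qed
    then have "L (\<lambda>x. indicat_real E x *\<^sub>R q) = (\<Sum>b\<in>Basis. (q \<bullet> b) * (LINT x:E|M. f b x))"
      by (simp only: linear_sum[OF L] linear_scale[OF L] f(2)[OF E] real_scaleR_def)
    also have "\<dots> = (\<Sum>b\<in>Basis. LINT x|M. (q \<bullet> b) * (indicat_real E x *\<^sub>R f b x))"
      unfolding set_lebesgue_integral_def by (intro sum.cong refl integral_mult_right_zero[symmetric])
    also have "\<dots> = (LINT x|M. (\<Sum>b\<in>Basis. (q \<bullet> b) * (indicat_real E x *\<^sub>R f b x)))"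
      by (intro Bochner_Integration.integral_sum[symmetric] integrable_mult_right
          integrable_mult_indicator[OF E f(1)])
    also have "\<dots> = (LINT x:E|M. \<xi> x \<bullet> q)"
      unfolding inner set_lebesgue_integral_def
      by (intro Bochner_Integration.integral_cong refl)
        (simp only: real_scaleR_def sum_distrib_left mult.left_commute[of "indicat_real E _"])
    finally show "L (\<lambda>x. indicat_real E x *\<^sub>R q) = (LINT x:E|M. \<xi> x \<bullet> q)" .
  qed
qed

text \<open>A Riesz representation theorem in which the majorant replaces the norm: it supplies both absolute
  continuity and the continuity needed to pass from simple functions to square-integrable ones.\<close>

theorem majorised_functional_density:
  obtains \<xi> where "square_integrable M \<xi>" "AE x in M. \<xi> x \<in> subdiff A (g x)"
    "\<And>h. square_integrable M h \<Longrightarrow> L h = (LINT x|M. \<xi> x \<bullet> h x)"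
proof -
  obtain \<xi> where \<xi>_meas: "\<xi> \<in> borel_measurable M" and \<xi>_int: "\<And>q. integrable M (\<lambda>x. \<xi> x \<bullet> q)"
    and L_ind: "\<And>E q. E \<in> sets M \<Longrightarrow> L (\<lambda>x. indicat_real E x *\<^sub>R q) = (LINT x:E|M. \<xi> x \<bullet> q)"
    by (rule majorised_functional_indicator) blast
  obtain D :: "'b set" where D: "countable D" "\<And>X. open X \<Longrightarrow> X \<noteq> {} \<Longrightarrow> \<exists>d\<in>D. d \<in> X"
    by (erule countable_dense_setE)
  have "AE x in M. \<xi> x \<bullet> q \<le> A (g x + q) - A (g x)" for q
  proof (rule AE_le_of_set_integral_le[OF \<xi>_int integrable_increment[OF g square_integrable_const]])
    fix E assume E: "E \<in> sets M"
    show "(LINT x:E|M. \<xi> x \<bullet> q) \<le> (LINT x:E|M. A (g x + q) - A (g x))"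
      using L_le[OF square_integrable_indicator_scaleR[OF E], of q] L_ind[OF E, of q]
      by (simp add: increment_indicator)
  qed
  then have "AE x in M. \<forall>q\<in>D. \<xi> x \<bullet> q \<le> A (g x + q) - A (g x)"
    using D(1) by (simp add: AE_ball_countable)
  then have subdiff: "AE x in M. \<xi> x \<in> subdiff A (g x)"
  proof eventually_elim
    case (elim x)
    \<comment> \<open>By continuity of \<open>A\<close> the inequality spreads from the dense set to all directions.\<close>
    let ?S = "{q. \<xi> x \<bullet> q \<le> A (g x + q) - A (g x)}"
    have "closed ?S"
      by (intro closed_Collect_le continuous_intros continuous_on_compose2[OF density_continuous]) auto
    then have "- ?S = {}"
      using D(2)[of "- ?S"] elim by (auto simp: open_Compl)
    then have "\<xi> x \<bullet> q \<le> A (g x + q) - A (g x)" for q by blast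
    from this[of "_ - g x"] show ?case by (simp add: subdiff_def)
  qed
  have \<xi>: "square_integrable M \<xi>"
  proof (rule square_integrable_bound[OF \<xi>_meas])
    show "integrable M (\<lambda>x. 24 * C\<^sup>2 * (norm (g x))\<^sup>2)"
      using g by (simp add: square_integrable_def)
    show "AE x in M. (norm (\<xi> x))\<^sup>2 \<le> 24 * C\<^sup>2 * (norm (g x))\<^sup>2"
      using subdiff by eventually_elim (rule subdiff_norm_bound[OF bound C_pos])
  qed
  \<comment> \<open>A simple function is a combination of indicators, up to its values outside the space of \<open>M\<close>.\<close>
  have L_simple: "L s = (LINT x|M. \<xi> x \<bullet> s x)" if s: "simple_function M s" for s
  proof -
    let ?E = "\<lambda>y. s -` {y} \<inter> space M"
    define s' where "s' = (\<Sum>y\<in>s ` space M. (\<lambda>x. indicat_real (?E y) x *\<^sub>R y))"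
    have fin: "finite (s ` space M)" and E: "\<And>y. ?E y \<in> sets M"
      using s by (auto intro: simple_functionD)
    have s'_apply: "s' x = (\<Sum>y\<in>s ` space M. indicat_real (?E y) x *\<^sub>R y)" for x
      unfolding s'_def by (rule fun_sum_apply)
    have eq: "s' x = s x" if "x \<in> space M" for x
    proof -
      have "s' x = (\<Sum>y\<in>s ` space M. if s x = y then y else 0)"
        unfolding s'_apply using that by (intro sum.cong) (auto simp: indicator_def)
      also have "\<dots> = s x"
        using that fin by simp
      finally show ?thesis .
    qed
    have "L (s - s') = 0"
    proof (rule majorised_functional_null)
      have "s - s' \<in> borel_measurable M \<longleftrightarrow> (\<lambda>x. 0 :: 'b) \<in> borel_measurable M"
        by (rule measurable_cong) (simp add: eq)
      then show "s - s' \<in> borel_measurable M" by simp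
      show "AE x in M. (s - s') x = 0"
        by (intro AE_I2) (simp add: eq)
    qed
    then have "L s = L s'" by (simp add: linear_diff[OF L])
    also have "\<dots> = (\<Sum>y\<in>s ` space M. LINT x:?E y|M. \<xi> x \<bullet> y)"
      by (simp only: s'_def linear_sum[OF L] L_ind[OF E])
    also have "\<dots> = (LINT x|M. (\<Sum>y\<in>s ` space M. indicat_real (?E y) x *\<^sub>R (\<xi> x \<bullet> y)))"
      unfolding set_lebesgue_integral_def
      by (rule Bochner_Integration.integral_sum[symmetric]) (rule integrable_mult_indicator[OF E \<xi>_int])
    also have "\<dots> = (LINT x|M. \<xi> x \<bullet> s x)"
    proof (intro Bochner_Integration.integral_cong refl)
      fix x assume x: "x \<in> space M"
      have "\<xi> x \<bullet> s x = \<xi> x \<bullet> s' x" using eq[OF x] by simp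
      then show "(\<Sum>y\<in>s ` space M. indicat_real (?E y) x *\<^sub>R (\<xi> x \<bullet> y)) = \<xi> x \<bullet> s x"
        by (simp only: s'_apply inner_sum_right inner_scaleR_right real_scaleR_def)
    qed
    finally show ?thesis .
  qed
  \<comment> \<open>Only one inequality is needed, since both sides are odd in \<open>h\<close>.\<close>
  have L_le_integral: "L h \<le> (LINT x|M. \<xi> x \<bullet> h x)" if h: "square_integrable M h" for h
  proof -
    have h_meas: "h \<in> borel_measurable M" using h by (simp add: square_integrable_def)
    obtain s where s_all: "(\<forall>i. simple_function M (s i)) \<and> (\<forall>x\<in>space M. (\<lambda>i. s i x) \<longlonglongrightarrow> h x) \<and>
        (\<forall>i. \<forall>x\<in>space M. dist (s i x) 0 \<le> 2 * dist (h x) 0)"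
      using borel_measurable_implies_sequence_metric[OF h_meas, of 0] by (elim exE)
    then have s: "\<And>i. simple_function M (s i)" "\<And>x. x \<in> space M \<Longrightarrow> (\<lambda>i. s i x) \<longlonglongrightarrow> h x"
      "\<And>i x. x \<in> space M \<Longrightarrow> norm (s i x) \<le> 2 * norm (h x)"
      by simp_all
    define d where "d i x = h x - s i x" for i x
    have d_bound: "norm (d i x) \<le> 3 * norm (h x)" if "x \<in> space M" for i x
      using norm_triangle_ineq4[of "h x" "s i x"] s(3)[OF that, of i] by (simp add: d_def)
    have d_meas: "d i \<in> borel_measurable M" for i
      unfolding d_def[abs_def] using h_meas borel_measurable_simple_function[OF s(1)] by (intro borel_measurable_diff)
    have d_sq_bound: "(norm (d i x))\<^sup>2 \<le> 9 * (norm (h x))\<^sup>2" if "x \<in> space M" for i x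
      using power_mono[OF d_bound[OF that] norm_ge_zero, where n=2] by (simp add: power_mult_distrib)
    have d: "square_integrable M (d i)" for i
    proof (rule square_integrable_bound[OF d_meas])
      show "integrable M (\<lambda>x. 9 * (norm (h x))\<^sup>2)"
        using h by (simp add: square_integrable_def)
    qed (use d_sq_bound in \<open>intro AE_I2\<close>)
    have s_sq: "square_integrable M (s i)" for i
      using square_integrable_diff[OF h d] by (simp add: d_def)
    let ?F = "\<lambda>i x. A (g x + d i x) - A (g x) - \<xi> x \<bullet> d i x"
    have F_int: "integrable M (?F i)" for i
      by (intro Bochner_Integration.integrable_diff[OF integrable_increment[OF g d]] square_integrable_inner \<xi> d)
    let ?B = "\<lambda>x. C * (2 * (norm (g x))\<^sup>2 + 18 * (norm (h x))\<^sup>2) + C * (norm (g x))\<^sup>2 + ((norm (\<xi> x))\<^sup>2 + 9 * (norm (h x))\<^sup>2)"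
    have "(\<lambda>i. LINT x|M. ?F i x) \<longlonglongrightarrow> (LINT x|M. 0)"
    proof (rule integral_dominated_convergence[where w="?B"])
      show "integrable M ?B"
        using g h \<xi> by (simp add: square_integrable_def)
      show "AE x in M. (\<lambda>i. ?F i x) \<longlonglongrightarrow> 0"
      proof (intro AE_I2)
        fix x assume x: "x \<in> space M"
        have d0: "(\<lambda>i. d i x) \<longlonglongrightarrow> 0"
          using tendsto_diff[OF tendsto_const s(2)[OF x], of "h x"] by (simp add: d_def)
        have "isCont A (g x)"
          using density_continuous by (simp add: continuous_on_eq_continuous_at)
        moreover have "(\<lambda>i. g x + d i x) \<longlonglongrightarrow> g x"
          using tendsto_add[OF tendsto_const d0, of "g x"] by simp
        ultimately have "(\<lambda>i. A (g x + d i x)) \<longlonglongrightarrow> A (g x)"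
          by (rule isCont_tendsto_compose)
        then have "(\<lambda>i. ?F i x) \<longlonglongrightarrow> A (g x) - A (g x) - \<xi> x \<bullet> 0"
          by (intro tendsto_intros d0)
        then show "(\<lambda>i. ?F i x) \<longlonglongrightarrow> 0" by simp
      qed
      show "AE x in M. norm (?F i x) \<le> ?B x" for i
      proof (intro AE_I2)
        fix x assume x: "x \<in> space M"
        have 1: "\<bar>A (g x + d i x)\<bar> \<le> C * (2 * (norm (g x))\<^sup>2 + 18 * (norm (h x))\<^sup>2)"
        proof -
          have "(norm (g x + d i x))\<^sup>2 \<le> 2 * (norm (g x))\<^sup>2 + 18 * (norm (h x))\<^sup>2"
            using norm_add_squared_le[of "g x" "d i x"] d_sq_bound[OF x, of i] by simp
          then show ?thesis
            by (intro order_trans[OF bound] mult_left_mono) (use C_pos in simp_all)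
        qed
        have 2: "\<bar>\<xi> x \<bullet> d i x\<bar> \<le> (norm (\<xi> x))\<^sup>2 + 9 * (norm (h x))\<^sup>2"
          using Cauchy_Schwarz_ineq2[of "\<xi> x" "d i x"] sum_squares_bound[of "norm (\<xi> x)" "norm (d i x)"]
            mult_nonneg_nonneg[of "norm (\<xi> x)" "norm (d i x)"] d_sq_bound[OF x, of i] by simp
        show "norm (?F i x) \<le> ?B x"
          unfolding real_norm_def using 1 2 bound[of "g x"] by linarith
      qed
    qed (use F_int in auto)
    moreover have "L h - (LINT x|M. \<xi> x \<bullet> h x) \<le> (LINT x|M. ?F i x)" for i
    proof -
      have "h = d i + s i" by (simp add: fun_eq_iff d_def)
      then have "L h = L (d i + s i)" by (rule arg_cong)
      also have "\<dots> = L (d i) + L (s i)" by (rule linear_add[OF L])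
      finally have "L h = L (d i) + L (s i)" .
      moreover have "(LINT x|M. \<xi> x \<bullet> h x) = (LINT x|M. \<xi> x \<bullet> d i x) + (LINT x|M. \<xi> x \<bullet> s i x)"
        using Bochner_Integration.integral_add[OF square_integrable_inner[OF \<xi> d] square_integrable_inner[OF \<xi> s_sq], of i i]
        by (simp add: d_def flip: inner_add_right)
      moreover have "(LINT x|M. ?F i x) = integral_increment M A g (d i) - (LINT x|M. \<xi> x \<bullet> d i x)"
        unfolding integral_increment_def
        by (intro Bochner_Integration.integral_diff integrable_increment square_integrable_inner g \<xi> d)
      ultimately show ?thesis
        using L_simple[OF s(1), of i] L_le[OF d, of i] by linarith
    qed
    ultimately have "L h - (LINT x|M. \<xi> x \<bullet> h x) \<le> (LINT x|M. 0)"
      by (intro LIMSEQ_le_const) auto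
    then show ?thesis by simp
  qed
  have "L h = (LINT x|M. \<xi> x \<bullet> h x)" if h: "square_integrable M h" for h
  proof -
    have "square_integrable M (- h)"
      using square_integrable_scaleR[OF h, of "- 1"] by (simp add: fun_Compl_def)
    from L_le_integral[OF this] have "- L h \<le> - (LINT x|M. \<xi> x \<bullet> h x)"
      by (simp add: linear_neg[OF L])
    with L_le_integral[OF h] show ?thesis by simp
  qed
  with \<xi> subdiff show thesis by (rule that)
qed

end

text \<open>Every linear functional on a space of functions that lies below the increment of \<open>\<integral> A\<close> at \<open>g\<close> is
  integration against a measurable selection of \<open>x \<mapsto> \<partial>A(g(x))\<close>. The functional is again given by its graph.\<close>

theorem convex_integral_subgradient:
  fixes R :: "(('a \<Rightarrow> 'b) \<times> real) set"
  assumes g: "square_integrable M g" and R: "subspace R"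
    and dom: "\<And>h c. (h, c) \<in> R \<Longrightarrow> square_integrable M h \<and> c \<le> integral_increment M A g h"
  obtains \<xi> where "square_integrable M \<xi>" "AE x in M. \<xi> x \<in> subdiff A (g x)"
    "\<And>h c. (h, c) \<in> R \<Longrightarrow> c = (LINT x|M. \<xi> x \<bullet> h x)"
proof -
  have zero: "integral_increment M A g 0 = 0"
    by (simp add: integral_increment_def)
  have dom': "h \<in> {h. square_integrable M h} \<and> c \<le> integral_increment M A g h" if "(h, c) \<in> R" for h c
    using dom[OF that] by simp
  show thesis
  proof (rule hahn_banach_convex[OF subspace_square_integrable convex_integral_increment[OF g] zero R dom'])
    fix L :: "('a \<Rightarrow> 'b) \<Rightarrow> real"
    assume L: "linear L" "\<And>h. h \<in> {h. square_integrable M h} \<Longrightarrow> L h \<le> integral_increment M A g h"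
      and L_R: "\<And>h c. (h, c) \<in> R \<Longrightarrow> L h = c"
    have L_le: "L h \<le> integral_increment M A g h" if "square_integrable M h" for h
      using L(2) that by simp
    show thesis
    proof (rule majorised_functional_density[OF g L(1) L_le])
      fix \<xi> assume \<xi>: "square_integrable M \<xi>" "AE x in M. \<xi> x \<in> subdiff A (g x)"
        and rep: "\<And>h. square_integrable M h \<Longrightarrow> L h = (LINT x|M. \<xi> x \<bullet> h x)"
      show thesis
      proof (rule that[OF \<xi>])
        fix h c assume hc: "(h, c) \<in> R"
        with dom have "square_integrable M h" by blast
        from rep[OF this] L_R[OF hc] show "c = (LINT x|M. \<xi> x \<bullet> h x)" by simp
      qed
    qed
  qed
qed

end

section \<open>Weak gradients of Sobolev functions\<close>

lemma L2_eq_square_integrable: "L2 \<Omega> = {f. square_integrable (lebesgue_on \<Omega>) f}"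
  by (auto simp: L2_def square_integrable_def)

lemma square_integrable_lebesgue_on_AE:
  fixes f g :: "'a::euclidean_space \<Rightarrow> 'b::euclidean_space"
  assumes \<Omega>: "\<Omega> \<in> sets lebesgue" and f: "square_integrable (lebesgue_on \<Omega>) f"
    and ae: "AE x in lebesgue_on \<Omega>. f x = g x"
  shows "square_integrable (lebesgue_on \<Omega>) g"
proof -
  have \<Omega>': "\<Omega> \<inter> space lebesgue \<in> sets lebesgue" using \<Omega> by simp
  have "(\<lambda>x. indicat_real \<Omega> x *\<^sub>R f x) \<in> borel_measurable lebesgue"
    using f unfolding square_integrable_def borel_measurable_restrict_space_iff[OF \<Omega>'] by blast
  moreover have "AE x in lebesgue. indicat_real \<Omega> x *\<^sub>R f x = indicat_real \<Omega> x *\<^sub>R g x"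
    using ae unfolding AE_restrict_space_iff[OF \<Omega>'] by eventually_elim (auto split: split_indicator)
  ultimately have "g \<in> borel_measurable (lebesgue_on \<Omega>)"
    unfolding borel_measurable_restrict_space_iff[OF \<Omega>'] by (rule borel_measurable_AE)
  then show ?thesis
  proof (rule square_integrable_bound)
    show "integrable (lebesgue_on \<Omega>) (\<lambda>x. (norm (f x))\<^sup>2)"
      using f by (simp add: square_integrable_def)
    show "AE x in lebesgue_on \<Omega>. (norm (g x))\<^sup>2 \<le> (norm (f x))\<^sup>2"
      using ae by eventually_elim simp
  qed
qed

lemma has_weak_gradient_weak_grad:
  "u \<in> H1 \<Omega> \<Longrightarrow> has_weak_gradient \<Omega> u (weak_grad \<Omega> u)"
  unfolding H1_def weak_grad_def using someI_ex[of "has_weak_gradient \<Omega> u"] by blast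

lemma weak_grad_square_integrable:
  fixes \<Omega> :: "'a::euclidean_space set"
  assumes "open \<Omega>" "u \<in> H1 \<Omega>"
  shows "square_integrable (lebesgue_on \<Omega>) (weak_grad \<Omega> u)"
proof -
  obtain g where g: "square_integrable (lebesgue_on \<Omega>) g" "has_weak_gradient \<Omega> u g"
    using assms(2) by (auto simp: H1_def L2_eq_square_integrable)
  have "AE x in lebesgue_on \<Omega>. g x = weak_grad \<Omega> u x"
    using weak_gradient_AE_unique[OF assms(1) g(2) has_weak_gradient_weak_grad[OF assms(2)]] .
  then show ?thesis
    by (rule square_integrable_lebesgue_on_AE[OF _ g(1), rotated]) (use assms(1) in simp)
qed

lemma H1_I:
  "square_integrable (lebesgue_on \<Omega>) u \<Longrightarrow> square_integrable (lebesgue_on \<Omega>) g \<Longrightarrow>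
    has_weak_gradient \<Omega> u g \<Longrightarrow> u \<in> H1 \<Omega>"
  by (auto simp: H1_def L2_eq_square_integrable)

lemma H1_square_integrable: "u \<in> H1 \<Omega> \<Longrightarrow> square_integrable (lebesgue_on \<Omega>) u"
  by (auto simp: H1_def L2_eq_square_integrable)

lemma H1_add:
  fixes \<Omega> :: "'a::euclidean_space set"
  assumes "open \<Omega>" "u \<in> H1 \<Omega>" "w \<in> H1 \<Omega>"
  shows "(\<lambda>x. u x + w x) \<in> H1 \<Omega>"
    and "AE x in lebesgue_on \<Omega>. weak_grad \<Omega> (\<lambda>x. u x + w x) x = weak_grad \<Omega> u x + weak_grad \<Omega> w x"
proof -
  have grad: "has_weak_gradient \<Omega> (\<lambda>x. u x + w x) (\<lambda>x. weak_grad \<Omega> u x + weak_grad \<Omega> w x)"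
    by (intro has_weak_gradient_add has_weak_gradient_weak_grad assms)
  show H1: "(\<lambda>x. u x + w x) \<in> H1 \<Omega>"
    by (rule H1_I[OF _ _ grad])
      (intro square_integrable_add weak_grad_square_integrable H1_square_integrable assms)+
  show "AE x in lebesgue_on \<Omega>. weak_grad \<Omega> (\<lambda>x. u x + w x) x = weak_grad \<Omega> u x + weak_grad \<Omega> w x"
    by (rule weak_gradient_AE_unique[OF assms(1) has_weak_gradient_weak_grad[OF H1] grad])
qed

lemma H1_scale:
  fixes \<Omega> :: "'a::euclidean_space set"
  assumes "open \<Omega>" "u \<in> H1 \<Omega>"
  shows "(\<lambda>x. c * u x) \<in> H1 \<Omega>"
    and "AE x in lebesgue_on \<Omega>. weak_grad \<Omega> (\<lambda>x. c * u x) x = c *\<^sub>R weak_grad \<Omega> u x"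
proof -
  have grad: "has_weak_gradient \<Omega> (\<lambda>x. c * u x) (\<lambda>x. c *\<^sub>R weak_grad \<Omega> u x)"
    by (intro has_weak_gradient_scaleR has_weak_gradient_weak_grad assms)
  show H1: "(\<lambda>x. c * u x) \<in> H1 \<Omega>"
    using square_integrable_scaleR[OF H1_square_integrable[OF assms(2)], of c]
    by (intro H1_I[OF _ _ grad] square_integrable_scaleR weak_grad_square_integrable assms) simp
  show "AE x in lebesgue_on \<Omega>. weak_grad \<Omega> (\<lambda>x. c * u x) x = c *\<^sub>R weak_grad \<Omega> u x"
    by (rule weak_gradient_AE_unique[OF assms(1) has_weak_gradient_weak_grad[OF H1] grad])
qed

lemma H1_diff:
  fixes \<Omega> :: "'a::euclidean_space set"
  assumes "open \<Omega>" "u \<in> H1 \<Omega>" "w \<in> H1 \<Omega>"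
  shows "(\<lambda>x. u x - w x) \<in> H1 \<Omega>"
    and "AE x in lebesgue_on \<Omega>. weak_grad \<Omega> (\<lambda>x. u x - w x) x = weak_grad \<Omega> u x - weak_grad \<Omega> w x"
proof -
  note w = H1_scale[OF assms(1,3), of "- 1"]
  note uw = H1_add[OF assms(1,2) w(1)]
  show "(\<lambda>x. u x - w x) \<in> H1 \<Omega>" using uw(1) by simp
  show "AE x in lebesgue_on \<Omega>. weak_grad \<Omega> (\<lambda>x. u x - w x) x = weak_grad \<Omega> u x - weak_grad \<Omega> w x"
    using uw(2) w(2) by eventually_elim simp
qed

section \<open>The subdifferential of a gradient energy\<close>

text \<open>An element \<open>v\<close> of the left side is represented by \<open>convex_integral_subgradient\<close>, applied to the graph of
  \<open>\<nabla>p \<mapsto> v(p)\<close>; an element of the right side is treated by integrating the pointwise subgradient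
  inequality.\<close>

theorem subdiff_grad_energy_eq:
  fixes \<Omega> :: "'a::euclidean_space set" and A :: "'a \<Rightarrow> real"
  assumes \<Omega>: "open \<Omega>" "bounded \<Omega>"
    and C: "C > 0" and bound: "\<And>q. \<bar>A q\<bar> \<le> C * (norm q)\<^sup>2" and convex: "convex_on UNIV A"
    and \<phi>: "\<phi> \<in> H1 \<Omega>"
  shows "H1_subdiff \<Omega> (grad_energy \<Omega> A) \<phi> = grad_subdiff \<Omega> A \<phi>"
proof -
  let ?M = "lebesgue_on \<Omega>" and ?g = "weak_grad \<Omega> \<phi>"
  have M: "finite_measure ?M"
    using \<Omega> by (simp add: finite_measure_lebesgue_on lmeasurable_open)
  have g: "square_integrable ?M ?g"
    by (rule weak_grad_square_integrable[OF \<Omega>(1) \<phi>])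
  have A_int: "integrable ?M (\<lambda>x. A (f x))" if "square_integrable ?M f" for f
    by (rule integrable_A[OF M C bound convex that])
  have grad_energy_add: "grad_energy \<Omega> A (\<lambda>x. \<phi> x + p x) - grad_energy \<Omega> A \<phi> = integral_increment ?M A ?g h"
    if p: "p \<in> H1 \<Omega>" and h: "square_integrable ?M h" and ae: "AE x in ?M. h x = weak_grad \<Omega> p x" for p h
  proof -
    note gh = square_integrable_add[OF g h]
    note add = H1_add[OF \<Omega>(1) \<phi> p]
    have "grad_energy \<Omega> A (\<lambda>x. \<phi> x + p x) = (LINT x|?M. A (?g x + h x))"
      unfolding grad_energy_def
    proof (rule integral_cong_AE)
      show "AE x in ?M. A (weak_grad \<Omega> (\<lambda>x. \<phi> x + p x) x) = A (?g x + h x)"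
        using add(2) ae by eventually_elim simp
    qed (intro borel_measurable_integrable A_int weak_grad_square_integrable \<Omega> add(1) gh)+
    then show ?thesis
      unfolding integral_increment_def grad_energy_def
      using Bochner_Integration.integral_diff[OF A_int[OF gh] A_int[OF g]] by simp
  qed
  show ?thesis
  proof
    show "H1_subdiff \<Omega> (grad_energy \<Omega> A) \<phi> \<subseteq> grad_subdiff \<Omega> A \<phi>"
    proof
      fix v assume "v \<in> H1_subdiff \<Omega> (grad_energy \<Omega> A) \<phi>"
      then have v: "v \<in> H1_dual \<Omega>" and sub: "\<And>\<eta>. \<eta> \<in> H1 \<Omega> \<Longrightarrow>
          v (\<lambda>x. \<eta> x - \<phi> x) \<le> grad_energy \<Omega> A \<eta> - grad_energy \<Omega> A \<phi>"
        by (auto simp: H1_subdiff_def)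
      have v_add: "v (\<lambda>x. p x + q x) = v p + v q" if "p \<in> H1 \<Omega>" "q \<in> H1 \<Omega>" for p q
        using v that by (simp add: H1_dual_def)
      have v_scale: "v (\<lambda>x. c * p x) = c * v p" if "p \<in> H1 \<Omega>" for c p
        using v that by (simp add: H1_dual_def)
      \<comment> \<open>The graph of \<open>\<nabla>p \<mapsto> v(p)\<close>, closed under changes of the gradient on null sets.\<close>
      define R where "R = {(h, c). square_integrable ?M h \<and>
          (\<exists>p\<in>H1 \<Omega>. (AE x in ?M. h x = weak_grad \<Omega> p x) \<and> c = v p)}"
      have scale_R: "(k *\<^sub>R h, k * c) \<in> R" if R: "(h, c) \<in> R" for k h c
      proof -
        obtain p where h: "square_integrable ?M h"
          and p: "p \<in> H1 \<Omega>" "AE x in ?M. h x = weak_grad \<Omega> p x" "c = v p"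
          using R by (auto simp: R_def)
        note kp = H1_scale[OF \<Omega>(1) p(1), of k]
        have "AE x in ?M. (k *\<^sub>R h) x = weak_grad \<Omega> (\<lambda>x. k * p x) x"
          using p(2) kp(2) by eventually_elim simp
        with kp(1) p v_scale[OF p(1), of k] square_integrable_scaleR[OF h, of k]
        show ?thesis
          unfolding R_def scaleR_fun_def by auto
      qed
      have "(?g, v \<phi>) \<in> R" using g \<phi> by (auto simp: R_def)
      from scale_R[OF this, of 0] have "0 \<in> R" by (simp add: zero_prod_def)
      have R: "subspace R"
      proof (rule subspaceI[OF \<open>0 \<in> R\<close>])
        show "k *\<^sub>R r \<in> R" if "r \<in> R" for k r
          using scale_R[of "fst r" "snd r" k] that by (simp add: scaleR_prod_def)
        fix r s assume "r \<in> R" "s \<in> R"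
        then obtain h p k q where r: "r = (h, v p)" "square_integrable ?M h" "p \<in> H1 \<Omega>"
            "AE x in ?M. h x = weak_grad \<Omega> p x"
          and s: "s = (k, v q)" "square_integrable ?M k" "q \<in> H1 \<Omega>" "AE x in ?M. k x = weak_grad \<Omega> q x"
          by (auto simp: R_def)
        note pq = H1_add[OF \<Omega>(1) r(3) s(3)]
        have "AE x in ?M. (h + k) x = weak_grad \<Omega> (\<lambda>x. p x + q x) x"
          using r(4) s(4) pq(2) by eventually_elim simp
        with pq(1) v_add[OF r(3) s(3)] square_integrable_add[OF r(2) s(2)]
        have "(h + k, v p + v q) \<in> R"
          unfolding R_def plus_fun_def by auto
        then show "r + s \<in> R" by (simp add: r(1) s(1))
      qed
      have dom: "square_integrable ?M h \<and> c \<le> integral_increment ?M A ?g h" if R: "(h, c) \<in> R" for h c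
      proof -
        obtain p where h: "square_integrable ?M h"
          and p: "p \<in> H1 \<Omega>" "AE x in ?M. h x = weak_grad \<Omega> p x" "c = v p"
          using R by (auto simp: R_def)
        have "(\<lambda>x. \<phi> x + p x - \<phi> x) = p" by simp
        with sub[OF H1_add(1)[OF \<Omega>(1) \<phi> p(1)]] grad_energy_add[OF p(1) h p(2)] h p(3)
        show ?thesis by simp
      qed
      show "v \<in> grad_subdiff \<Omega> A \<phi>"
      proof (rule convex_integral_subgradient[OF M C bound convex g R dom])
        fix \<xi> assume \<xi>: "square_integrable ?M \<xi>" "AE x in ?M. \<xi> x \<in> subdiff A (?g x)"
          and rep: "\<And>h c. (h, c) \<in> R \<Longrightarrow> c = (LINT x|?M. \<xi> x \<bullet> h x)"
        have "v p = (LINT x|?M. \<xi> x \<bullet> weak_grad \<Omega> p x)" if "p \<in> H1 \<Omega>" for p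
          using that weak_grad_square_integrable[OF \<Omega>(1) that] by (intro rep) (auto simp: R_def)
        with v \<xi> show ?thesis
          by (auto simp: grad_subdiff_def L2_eq_square_integrable)
      qed
    qed
    show "grad_subdiff \<Omega> A \<phi> \<subseteq> H1_subdiff \<Omega> (grad_energy \<Omega> A) \<phi>"
    proof
      fix v assume "v \<in> grad_subdiff \<Omega> A \<phi>"
      then obtain \<xi> where v: "v \<in> H1_dual \<Omega>" and \<xi>: "square_integrable ?M \<xi>"
        and sub: "AE x in ?M. \<xi> x \<in> subdiff A (?g x)"
        and rep: "\<And>p. p \<in> H1 \<Omega> \<Longrightarrow> v p = (LINT x|?M. \<xi> x \<bullet> weak_grad \<Omega> p x)"
        by (auto simp: grad_subdiff_def L2_eq_square_integrable)
      have "v (\<lambda>x. \<eta> x - \<phi> x) \<le> grad_energy \<Omega> A \<eta> - grad_energy \<Omega> A \<phi>" if \<eta>: "\<eta> \<in> H1 \<Omega>" for \<eta>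
      proof -
        note diff = H1_diff[OF \<Omega>(1) \<eta> \<phi>]
        note d = weak_grad_square_integrable[OF \<Omega>(1) diff(1)]
        note e = weak_grad_square_integrable[OF \<Omega>(1) \<eta>]
        have "v (\<lambda>x. \<eta> x - \<phi> x) = (LINT x|?M. \<xi> x \<bullet> weak_grad \<Omega> (\<lambda>x. \<eta> x - \<phi> x) x)"
          by (rule rep[OF diff(1)])
        also have "\<dots> \<le> (LINT x|?M. A (weak_grad \<Omega> \<eta> x) - A (?g x))"
        proof (rule integral_mono_AE)
          show "AE x in ?M. \<xi> x \<bullet> weak_grad \<Omega> (\<lambda>x. \<eta> x - \<phi> x) x \<le> A (weak_grad \<Omega> \<eta> x) - A (?g x)"
            using sub diff(2) by eventually_elim (simp add: subdiff_def)
        qed (intro square_integrable_inner[OF \<xi> d] Bochner_Integration.integrable_diff A_int e g)+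
        also have "\<dots> = grad_energy \<Omega> A \<eta> - grad_energy \<Omega> A \<phi>"
          unfolding grad_energy_def by (rule Bochner_Integration.integral_diff[OF A_int[OF e] A_int[OF g]])
        finally show ?thesis .
      qed
      with v show "v \<in> H1_subdiff \<Omega> (grad_energy \<Omega> A) \<phi>"
        by (simp add: H1_subdiff_def)
    qed
  qed
qed

text \<open>Homogeneity reduces the bound to the unit sphere, which is compact.\<close>

lemma gauge_le_norm:
  fixes \<gamma> :: "'a::euclidean_space \<Rightarrow> real"
  assumes homogeneous: "\<And>q t. q \<noteq> 0 \<Longrightarrow> t \<ge> 0 \<Longrightarrow> \<gamma> (t *\<^sub>R q) = t * \<gamma> q"
    and cont: "continuous_on UNIV \<gamma>"
  obtains B where "\<And>q. \<bar>\<gamma> q\<bar> \<le> B * norm q"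
proof -
  have "compact (\<gamma> ` sphere 0 1)"
    using cont by (intro compact_continuous_image) (auto intro: continuous_on_subset)
  then obtain B where "\<forall>x\<in>sphere 0 1. \<bar>\<gamma> x\<bar> \<le> B"
    by (auto dest!: compact_imp_bounded simp: bounded_iff)
  then have B: "\<bar>\<gamma> q\<bar> \<le> B" if "norm q = 1" for q
    using that by simp
  have "\<bar>\<gamma> q\<bar> \<le> B * norm q" for q
  proof (cases "q = 0")
    case True
    obtain i :: 'a where "i \<in> Basis" using nonempty_Basis by blast
    then have "\<gamma> 0 = 0"
      using homogeneous[of i 0] nonzero_Basis[of i] by auto
    with True show ?thesis by simp
  next
    case False
    have "\<gamma> q = norm q * \<gamma> (sgn q)"
      using homogeneous[of "sgn q" "norm q"] False by (simp add: sgn_div_norm)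
    with B[of "sgn q"] False show ?thesis
      by (simp add: abs_mult norm_sgn mult.commute mult_left_mono)
  qed
  then show thesis by (rule that)
qed

text \<open>Squaring is convex, and increasing on the values of \<open>\<gamma>\<close>. With weights \<open>1 - t\<close> and \<open>t\<close> the defect of
  convexity of the square is \<open>t (1 - t) (\<gamma>(x) - \<gamma>(y))\<^sup>2\<close>.\<close>

lemma convex_on_half_square:
  assumes cvx: "convex_on S \<gamma>" and nonneg: "\<And>q. q \<in> S \<Longrightarrow> 0 \<le> \<gamma> q"
  shows "convex_on S (\<lambda>q. 1/2 * \<bar>\<gamma> q\<bar>\<^sup>2)"
proof (rule convex_onI)
  show S: "convex S" using cvx by (rule convex_on_imp_convex)
  fix t :: real and x y assume t: "0 < t" "t < 1" and xy: "x \<in> S" "y \<in> S"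
  have "\<gamma> ((1 - t) *\<^sub>R x + t *\<^sub>R y) \<le> (1 - t) * \<gamma> x + t * \<gamma> y"
    using t xy by (intro convex_onD[OF cvx]) auto
  moreover have "0 \<le> \<gamma> ((1 - t) *\<^sub>R x + t *\<^sub>R y)"
    using t xy by (intro nonneg convexD[OF S]) auto
  ultimately have "(\<gamma> ((1 - t) *\<^sub>R x + t *\<^sub>R y))\<^sup>2 \<le> ((1 - t) * \<gamma> x + t * \<gamma> y)\<^sup>2"
    by (rule power_mono)
  also have "\<dots> = (1 - t) * (\<gamma> x)\<^sup>2 + t * (\<gamma> y)\<^sup>2 - t * (1 - t) * (\<gamma> x - \<gamma> y)\<^sup>2"
    by (simp add: power2_eq_square algebra_simps)
  also have "\<dots> \<le> (1 - t) * (\<gamma> x)\<^sup>2 + t * (\<gamma> y)\<^sup>2"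
    using t by simp
  finally show "1/2 * \<bar>\<gamma> ((1 - t) *\<^sub>R x + t *\<^sub>R y)\<bar>\<^sup>2 \<le> (1 - t) * (1/2 * \<bar>\<gamma> x\<bar>\<^sup>2) + t * (1/2 * \<bar>\<gamma> y\<bar>\<^sup>2)"
    by simp
qed

theorem lemma3p1:
  fixes \<Omega> :: "'a::euclidean_space set" and \<gamma> :: "'a \<Rightarrow> real"
  assumes domain: "open \<Omega>" "connected \<Omega>" "\<Omega> \<noteq> {}" "bounded \<Omega>" "lipschitz_boundary \<Omega>"
    and homogeneous: "\<And>q t. q \<noteq> 0 \<Longrightarrow> t \<ge> 0 \<Longrightarrow> \<gamma> (t *\<^sub>R q) = t * \<gamma> q"
    and positive: "\<And>q. q \<noteq> 0 \<Longrightarrow> \<gamma> q > 0"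
    and convex: "convex_on UNIV \<gamma>"
  shows "\<forall>\<phi>\<in>H1_subdiff_dom \<Omega> (grad_energy \<Omega> (aniso_density \<gamma>)).
    H1_subdiff \<Omega> (grad_energy \<Omega> (aniso_density \<gamma>)) \<phi> = grad_subdiff \<Omega> (aniso_density \<gamma>) \<phi>"
proof
  fix \<phi> assume "\<phi> \<in> H1_subdiff_dom \<Omega> (grad_energy \<Omega> (aniso_density \<gamma>))"
  then have \<phi>: "\<phi> \<in> H1 \<Omega>" by (simp add: H1_subdiff_dom_def)
  obtain B where B: "\<And>q. \<bar>\<gamma> q\<bar> \<le> B * norm q"
    using gauge_le_norm[OF homogeneous convex_on_continuous[OF open_UNIV convex]] by blast
  have nonneg: "0 \<le> \<gamma> q" for q
    using positive[of q] B[of 0] by (cases "q = 0") auto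
  have cvx: "convex_on UNIV (aniso_density \<gamma>)"
    unfolding aniso_density_def[abs_def] by (rule convex_on_half_square[OF convex nonneg])
  have bound: "\<bar>aniso_density \<gamma> q\<bar> \<le> (B\<^sup>2 + 1) * (norm q)\<^sup>2" for q
  proof -
    have "\<bar>\<gamma> q\<bar>\<^sup>2 \<le> (B * norm q)\<^sup>2"
      by (intro power_mono B) simp
    then have "(\<gamma> q)\<^sup>2 \<le> B\<^sup>2 * (norm q)\<^sup>2"
      by (simp add: power_mult_distrib)
    moreover have "\<bar>aniso_density \<gamma> q\<bar> = (\<gamma> q)\<^sup>2 / 2"
      by (simp add: aniso_density_def)
    moreover have "0 \<le> (norm q)\<^sup>2" "0 \<le> (\<gamma> q)\<^sup>2" by simp_all
    ultimately show ?thesis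
      unfolding distrib_right by linarith
  qed
  have "0 < B\<^sup>2 + 1" by (simp add: add_nonneg_pos)
  from subdiff_grad_energy_eq[OF domain(1,4) this bound cvx \<phi>]
  show "H1_subdiff \<Omega> (grad_energy \<Omega> (aniso_density \<gamma>)) \<phi> = grad_subdiff \<Omega> (aniso_density \<gamma>) \<phi>" .
qed

end
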